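(* Let $T>0$ and let $\mathcal{C}$ be a monotone $m$-port circuit with $n$ elements. Let $v_k, i_k$, $k=1,\ldots,m$, denote its driving point voltages and currents. Then there exist: 1. a partition of the driving point voltages $\{v_k\}_{k=1,\ldots,m}$ and driving point currents $\{i_k\}_{k=1,\ldots,m}$ into vectors $\mathbf{u},\mathbf{y}\in L_{2,T}^m$ (an excitation vector and a response vector); 2. vectors $\mathbf{i}\in L_{2,T}^p$ and $\mathbf{v}\in L_{2,T}^q$, $p+q=n$, such that for each element either the voltage across it is in $\mathbf{v}$ or the current through it is in $\mathbf{i}$; 3. matrices $\tilde M\in\mathbb{R}^{q\times p}$, $\tilde B_R\in\mathbb{R}^{p\times m}$, $\tilde B_G\in\mathbb{R}^{q\times m}$ and $\tilde D\in\mathbb{R}^{m\times m}$; and 4. (possibly multi-valued) monotone operators $R$ on $L_{2,T}^p$ and $G$ on $L_{2,T}^q$, which are the concatenation of, respectively, the impedances of the elements whose currents are in $\mathbf{i}$ and the admittances of the elements whose voltages are in $\mathbf{v}$; such that the behavior of $\mathcal{C}$ on $L_{2,T}$ is the set of solutions to $$0\in\begin{pmatrix} R(\mathbf{i})\\ G(\mathbf{v})\end{pmatrix}+\begin{pmatrix} \mathbf{0} & M^\top\\ -M & \mathbf{0}\end{pmatrix}\begin{pmatrix}\mathbf{i}\\ \mathbf{v}\end{pmatrix}-\begin{pmatrix} B_R\\ B_G\end{pmatrix}\mathbf{u},$$ $$\mathbf{y}=-\begin{pmatrix} B_R^\top & B_G^\top\end{pmatrix}\begin{pmatrix}\mathbf{i}\\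 \mathbf{v}\end{pmatrix}+D\,\mathbf{u},$$ where $M=\tilde M\otimes\mathrm{Id}$, $B_R=\tilde B_R\otimes\mathrm{Id}$, $B_G=\tilde B_G\otimes\mathrm{Id}$ and $D=\tilde D\otimes\mathrm{Id}$.
   Context: **Signal space.** For $T>0$, $L_{2,T}^m$ is the Hilbert space of square-integrable signals $[0,T]\to\mathbb{R}^m$ with inner product $\langle u,y\rangle=\int_0^T u(t)^\top y(t)\,dt$, and $L_{2,T}=L_{2,T}^1$. $T$-periodic signals are identified with their restriction to one period. $\mathrm{Id}$ is the identity operator on $L_{2,T}$. For a real matrix $\tilde A$, $\tilde A\otimes\mathrm{Id}$ acts on vectors of signals by $((\tilde A\otimes\mathrm{Id})x)(t)=\tilde A\,x(t)$, and its transpose is $\tilde A^\top\otimes\mathrm{Id}$. **Operators.** An operator on a Hilbert space $\mathcal{H}$ is a possibly multi-valued map $A:\mathcal{H}\to 2^{\mathcal{H}}$, with relation $\operatorname{rel}(A)=\{(u,y): y\in A(u)\}$. It is monotone if $\langle u_1-u_2,y_1-y_2\rangle\ge 0$ for all $(u_1,y_1),(u_2,y_2)\in\operatorname{rel}(A)$, and maximal if its relation is not properly contained in the relation of another monotone operator. The inverse $A^{-1}$ is the relational inverse, $\operatorname{rel}(A^{-1})=\{(y,u):(u,y)\in\operatorname{rel}(A)\}$; its domain may be a proper subset of $\mathcal{H}$. **Circuit elements.** A one-port circuit is a circuit with two terminals, described by a relation between the voltage between the terminals and the current through them. Each circuit element is a one-port circuit described by a maximal monotone operator on $L_{2,T}$,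 either from voltage to current (admittance) or from current to voltage (impedance). The impedance and admittance of the same element are relational inverses of one another, so both always exist as possibly multi-valued operators, possibly with restricted domain. "Concatenation" of element operators means the operator acting componentwise (diagonally). **Ideal transformers.** An ideal $(a+b)$-port transformer with turns ratio matrix $K\in\mathbb{R}^{b\times a}$ is the device defined by $$\begin{pmatrix}\mathbf{i}_1(t)\\ \mathbf{v}_2(t)\end{pmatrix}=\begin{pmatrix}0&K^\top\\-K&0\end{pmatrix}\begin{pmatrix}\mathbf{v}_1(t)\\ \mathbf{i}_2(t)\end{pmatrix}\quad\text{for all } t,$$ where $\mathbf{v}_1,\mathbf{i}_1$ are the voltages and currents at its first $a$ ports and $\mathbf{v}_2,\mathbf{i}_2$ those at its other $b$ ports. **Monotone $m$-port circuit with $n$ elements.** This is a circuit constructed as follows. Begin with a box of wires and ideal transformers, connected arbitrarily. From this box draw $m$ pairs of terminals, forming $m$ external driving points. Draw a further $n$ pairs of terminals, and across each of these connect one monotone one-port circuit element, that is, a one-port circuit described by a maximal monotone operator on $L_{2,T}$, either from voltage to current (admittance) or from current to voltage (impedance). The box is governed by Kirchhoff's current and voltage laws and the ideal transformer relations. At every terminal pair $k=1,\ldots,m+n$ of the box, the voltage $v_k$ and current $i_k$ are oriented so that $i_k(t)v_k(t)$ is the instantaneous power extracted from the box. For the $n$ internal pairs, this coincides with the usual orientation of the voltage across, and current through, the connected element. An excitation at a driving point is an applied voltage (respectively current), and the response is the resulting current (respectively voltage) there. **Behavior.** Collect the $m$ driving point currents and the $n$ element currents in $\iota\in L_{2,T}^{m+n}$,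 and the $m$ driving point voltages and the $n$ element voltages in $\nu\in L_{2,T}^{m+n}$. The behavior of $\mathcal{C}$ on $L_{2,T}$ is the set of all $(\iota,\nu)\in L_{2,T}^{m+n}\times L_{2,T}^{m+n}$ that obey the circuit interconnection constraints (Kirchhoff's laws and transformer relations of the box) and the device laws of all $n$ elements. When the behavior is expressed by equations in $\mathbf{u},\mathbf{y},\mathbf{i},\mathbf{v}$, the remaining internal variables (voltages of the elements whose currents are in $\mathbf{i}$, and currents of the elements whose voltages are in $\mathbf{v}$) are the values selected from $R(\mathbf{i})$ and $G(\mathbf{v})$ for which the inclusion holds with equality to $0$. *)

theory Defs
  imports "HOL-Analysis.Analysis" "Jordan_Normal_Form.Matrix"
begin

no_notation vec_nth (infixl \<open>$\<close> 90)

section \<open>The signal space\<close>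

text \<open>
  The type \<open>signal\<close> is the Hilbert space of square-integrable functions on the real line modulo
  equality almost everywhere. The space of signals on the period \<open>[0, T]\<close> is its closed subspace
  \<open>L2T T\<close> of signals that vanish outside \<open>[0, T]\<close>: each signal on the period is extended by zero.
  This makes the period an ordinary parameter and leaves the inner product unchanged, see
  \<open>inner_L2T\<close> below.
\<close>

definition square_integrable :: "(real \<Rightarrow> real) \<Rightarrow> bool" where
  "square_integrable f \<longleftrightarrow>
     f \<in> borel_measurable lebesgue \<and> integrable lebesgue (\<lambda>t. (f t)\<^sup>2)"

definition ae_eq :: "(real \<Rightarrow> real) \<Rightarrow> (real \<Rightarrow> real) \<Rightarrow> bool" where
  "ae_eq f g \<longleftrightarrow> square_integrable f \<and> square_integrable g \<and> (AE t in lebesgue. f t = g t)"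

lemma square_integrable_mult:
  assumes "square_integrable f" "square_integrable g"
  shows "integrable lebesgue (\<lambda>t. f t * g t)"
proof (rule Bochner_Integration.integrable_bound)
  show "integrable lebesgue (\<lambda>t. (f t)\<^sup>2 + (g t)\<^sup>2)"
    using assms by (auto simp: square_integrable_def)
  show "(\<lambda>t. f t * g t) \<in> borel_measurable lebesgue"
    using assms by (auto simp: square_integrable_def)
  have "\<bar>x * y\<bar> \<le> x\<^sup>2 + y\<^sup>2" for x y :: real
  proof -
    have "2 * (\<bar>x\<bar> * \<bar>y\<bar>) \<le> x\<^sup>2 + y\<^sup>2"
      using sum_squares_bound[of "\<bar>x\<bar>" "\<bar>y\<bar>"] by simp
    moreover have "0 \<le> \<bar>x\<bar> * \<bar>y\<bar>"
      by simp
    ultimately show ?thesis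
      unfolding abs_mult by linarith
  qed
  then show "AE t in lebesgue. norm (f t * g t) \<le> norm ((f t)\<^sup>2 + (g t)\<^sup>2)"
    by auto
qed

lemma square_integrable_add:
  assumes "square_integrable f" "square_integrable g"
  shows "square_integrable (\<lambda>t. f t + g t)"
  using assms square_integrable_mult[OF assms]
  by (auto simp: square_integrable_def power2_sum mult.assoc)

lemma square_integrable_scale:
  "square_integrable f \<Longrightarrow> square_integrable (\<lambda>t. c * f t)"
  by (auto simp: square_integrable_def power_mult_distrib)

lemma square_integrable_uminus:
  "square_integrable f \<Longrightarrow> square_integrable (\<lambda>t. - f t)"
  by (auto simp: square_integrable_def)

lemma square_integrable_diff:
  assumes "square_integrable f" "square_integrable g"
  shows "square_integrable (\<lambda>t. f t - g t)"
  using square_integrable_add[OF assms(1) square_integrable_uminus[OF assms(2)]] by simp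

lemma square_integrable_zero: "square_integrable (\<lambda>t. 0)"
  by (auto simp: square_integrable_def)

quotient_type signal = "real \<Rightarrow> real" / partial: ae_eq
proof (rule part_equivpI)
  show "\<exists>f. ae_eq f f"
    using square_integrable_zero by (auto simp: ae_eq_def)
  show "symp ae_eq"
    by (auto simp: symp_def ae_eq_def)
  show "transp ae_eq"
    by (auto simp: transp_def ae_eq_def)
qed

instantiation signal :: real_vector
begin

lift_definition zero_signal :: signal is "\<lambda>t. 0"
  by (auto simp: ae_eq_def square_integrable_zero)

lift_definition plus_signal :: "signal \<Rightarrow> signal \<Rightarrow> signal" is "\<lambda>f g t. f t + g t"
  by (auto simp: ae_eq_def square_integrable_add)

lift_definition uminus_signal :: "signal \<Rightarrow> signal" is "\<lambda>f t. - f t"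
  by (auto simp: ae_eq_def square_integrable_uminus)

lift_definition minus_signal :: "signal \<Rightarrow> signal \<Rightarrow> signal" is "\<lambda>f g t. f t - g t"
  by (auto simp: ae_eq_def square_integrable_diff)

lift_definition scaleR_signal :: "real \<Rightarrow> signal \<Rightarrow> signal" is "\<lambda>c f t. c * f t"
  by (auto simp: ae_eq_def square_integrable_scale)

instance
  by standard
    (transfer; simp add: ae_eq_def square_integrable_add square_integrable_scale
      square_integrable_uminus square_integrable_diff square_integrable_zero algebra_simps)+

end

instantiation signal :: real_inner
begin

lift_definition inner_signal :: "signal \<Rightarrow> signal \<Rightarrow> real" is
  "\<lambda>f g. \<integral>t. f t * g t \<partial>lebesgue"
  by (rule integral_cong_AE) (auto simp: ae_eq_def square_integrable_def)

definition norm_signal :: "signal \<Rightarrow> real" where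
  "norm_signal x = sqrt (inner x x)"

definition dist_signal :: "signal \<Rightarrow> signal \<Rightarrow> real" where
  "dist_signal x y = norm (x - y)"

definition sgn_signal :: "signal \<Rightarrow> signal" where
  "sgn_signal x = x /\<^sub>R norm x"

definition uniformity_signal :: "(signal \<times> signal) filter" where
  "uniformity_signal = (INF e\<in>{0<..}. principal {(x, y). dist x y < e})"

definition open_signal :: "signal set \<Rightarrow> bool" where
  "open_signal U \<longleftrightarrow>
     (\<forall>x\<in>U. eventually (\<lambda>(x', y). x' = x \<longrightarrow> y \<in> U) uniformity)"

instance
proof
  fix x y z :: signal and r :: real
  show "inner x y = inner y x"
    by transfer (simp add: mult.commute)
  show "inner (x + y) z = inner x z + inner y z"
    by transfer (simp add: ae_eq_def distrib_right square_integrable_mult)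
  show "inner (r *\<^sub>R x) y = r * inner x y"
    by transfer (simp add: ae_eq_def mult.assoc)
  show "0 \<le> inner x x"
    by transfer simp
  show "inner x x = 0 \<longleftrightarrow> x = 0"
  proof transfer
    fix f :: "real \<Rightarrow> real"
    assume "ae_eq f f"
    then have f: "square_integrable f"
      by (simp add: ae_eq_def)
    then have "(\<integral>t. f t * f t \<partial>lebesgue) = 0 \<longleftrightarrow> (AE t in lebesgue. f t * f t = 0)"
      by (intro integral_nonneg_eq_0_iff_AE square_integrable_mult) auto
    then show "(\<integral>t. f t * f t \<partial>lebesgue) = 0 \<longleftrightarrow> ae_eq f (\<lambda>t. 0)"
      using f by (simp add: ae_eq_def square_integrable_zero)
  qed
qed (simp_all add: dist_signal_def norm_signal_def sgn_signal_def uniformity_signal_def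
      open_signal_def)

end

lift_definition supported_in :: "signal \<Rightarrow> real set \<Rightarrow> bool" is
  "\<lambda>f S. AE t in lebesgue. t \<notin> S \<longrightarrow> f t = 0"
proof (rule ext)
  fix f g :: "real \<Rightarrow> real" and S
  assume "ae_eq f g"
  then have "AE t in lebesgue. f t = g t"
    by (simp add: ae_eq_def)
  then have "AE t in lebesgue. (t \<notin> S \<longrightarrow> f t = 0) = (t \<notin> S \<longrightarrow> g t = 0)"
    by eventually_elim simp
  then show "(AE t in lebesgue. t \<notin> S \<longrightarrow> f t = 0) = (AE t in lebesgue. t \<notin> S \<longrightarrow> g t = 0)"
    by (rule eventually_subst)
qed

definition L2T :: "real \<Rightarrow> signal set" where
  "L2T T = {x. supported_in x {0..T}}"

lemma inner_L2T:
  assumes "abs_signal f \<in> L2T T" "square_integrable f" "square_integrable g"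
  shows "inner (abs_signal f) (abs_signal g) = (LINT t:{0..T}|lebesgue. f t * g t)"
proof -
  have r: "ae_eq f f" "ae_eq g g"
    using assms by (auto simp: ae_eq_def)
  have "AE t in lebesgue. t \<notin> {0..T} \<longrightarrow> f t = 0"
    using assms(1) r by (simp add: L2T_def supported_in.abs_eq)
  then have "AE t in lebesgue. f t * g t = indicator {0..T} t *\<^sub>R (f t * g t)"
    by eventually_elim (auto simp: indicator_def)
  moreover have "f \<in> borel_measurable lebesgue" "g \<in> borel_measurable lebesgue"
    using assms by (auto simp: square_integrable_def)
  moreover have "indicator {0..T} \<in> borel_measurable lebesgue"
    by (intro borel_measurable_indicator) simp
  ultimately show ?thesis
    unfolding set_lebesgue_integral_def inner_signal.abs_eq[OF r]
    by (intro integral_cong_AE borel_measurable_scaleR borel_measurable_times)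
qed

text \<open>Vectors of \<open>k\<close> signals, i.e. the \<open>k\<close>-fold product Hilbert space.\<close>

definition L2T_vec :: "real \<Rightarrow> nat \<Rightarrow> signal vec set" where
  "L2T_vec T k = {x \<in> carrier_vec k. \<forall>j<k. x $ j \<in> L2T T}"

definition inner_vec :: "signal vec \<Rightarrow> signal vec \<Rightarrow> real" where
  "inner_vec x y = (\<Sum>j<dim_vec y. inner (x $ j) (y $ j))"

definition tensor_Id :: "real mat \<Rightarrow> signal vec \<Rightarrow> signal vec" where
  "tensor_Id A x = Matrix.vec (dim_row A) (\<lambda>i. \<Sum>j<dim_col A. A $$ (i, j) *\<^sub>R x $ j)"


section \<open>Operators\<close>

text \<open>
  A multi-valued operator is given by its relation. It lives on a set \<open>H\<close> equipped with the inner
  product \<open>ip\<close>, so that the same notion serves \<open>L2T T\<close> and \<open>L2T_vec T k\<close>.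
\<close>

definition monotone_operator ::
  "'h set \<Rightarrow> ('h \<Rightarrow> 'h \<Rightarrow> real) \<Rightarrow> ('h::minus \<times> 'h) set \<Rightarrow> bool" where
  "monotone_operator H ip A \<longleftrightarrow> A \<subseteq> H \<times> H \<and>
     (\<forall>(u1, y1)\<in>A. \<forall>(u2, y2)\<in>A. 0 \<le> ip (u1 - u2) (y1 - y2))"

definition maximal_monotone_operator ::
  "'h set \<Rightarrow> ('h \<Rightarrow> 'h \<Rightarrow> real) \<Rightarrow> ('h::minus \<times> 'h) set \<Rightarrow> bool" where
  "maximal_monotone_operator H ip A \<longleftrightarrow> monotone_operator H ip A \<and>
     (\<nexists>B. monotone_operator H ip B \<and> A \<subset> B)"

definition concatenation :: "(signal \<times> signal) set list \<Rightarrow> (signal vec \<times> signal vec) set" where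
  "concatenation As = {(x, y). x \<in> carrier_vec (length As) \<and> y \<in> carrier_vec (length As) \<and>
     (\<forall>j<length As. (x $ j, y $ j) \<in> As ! j)}"


section \<open>Circuits\<close>

text \<open>
  A circuit element: an impedance maps current to voltage, an admittance voltage to current.
\<close>

datatype element = Impedance "(signal \<times> signal) set" | Admittance "(signal \<times> signal) set"

fun operator_of :: "element \<Rightarrow> (signal \<times> signal) set" where
  "operator_of (Impedance A) = A"
| "operator_of (Admittance A) = A"

fun impedance :: "element \<Rightarrow> (signal \<times> signal) set" where
  "impedance (Impedance A) = A"
| "impedance (Admittance A) = A\<inverse>"

fun admittance :: "element \<Rightarrow> (signal \<times> signal) set" where
  "admittance (Impedance A) = A\<inverse>"
| "admittance (Admittance A) = A"

text \<open>
  The network is a directed multigraph. Its branches are the terminal pairs \<open>Terminals k\<close> of the box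
  (the first \<open>num_ports\<close> of them are the driving points, the others carry the elements), the wires,
  and the ports of the transformers, \<open>Winding l j\<close> being the \<open>j\<close>-th port of the \<open>l\<close>-th
  transformer. A transformer with turns ratio matrix \<open>K\<close> has \<open>a = dim_col K\<close> first and
  \<open>b = dim_row K\<close> second ports, numbered consecutively. The current of a branch is counted from
  \<open>pos\<close> to \<open>neg\<close> through the branch, and its voltage is that of \<open>pos\<close> relative to \<open>neg\<close>. Hence the
  product of the two is the power delivered to the branch, which for a \<open>Terminals k\<close> is the power
  extracted from the box.
\<close>

datatype branch = Terminals nat | Wire nat | Winding nat nat

record 'v circuit =
  num_ports :: nat
  elements :: "element list"
  num_wires :: nat
  transformers :: "real mat list"
  pos :: "branch \<Rightarrow> 'v"
  neg :: "branch \<Rightarrow> 'v"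

definition monotone_circuit :: "real \<Rightarrow> nat \<Rightarrow> nat \<Rightarrow> 'v circuit \<Rightarrow> bool" where
  "monotone_circuit T m n C \<longleftrightarrow> num_ports C = m \<and> length (elements C) = n \<and>
     (\<forall>e\<in>set (elements C). maximal_monotone_operator (L2T T) inner (operator_of e))"

definition num_pairs :: "'v circuit \<Rightarrow> nat" where
  "num_pairs C = num_ports C + length (elements C)"

definition branches :: "'v circuit \<Rightarrow> branch set" where
  "branches C = Terminals ` {..<num_pairs C} \<union> Wire ` {..<num_wires C} \<union>
     {Winding l j | l j. l < length (transformers C) \<and>
        j < dim_col (transformers C ! l) + dim_row (transformers C ! l)}"

definition KCL :: "'v circuit \<Rightarrow> (branch \<Rightarrow> signal) \<Rightarrow> bool" where
  "KCL C I \<longleftrightarrow>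
     (\<forall>x. (\<Sum>b | b \<in> branches C \<and> pos C b = x. I b) = (\<Sum>b | b \<in> branches C \<and> neg C b = x. I b))"

text \<open>
  \<open>walk C x ss y\<close>: the list \<open>ss\<close> of branches leads from \<open>x\<close> to \<open>y\<close>, where the flag tells whether
  a branch is traversed from \<open>pos\<close> to \<open>neg\<close> or in the opposite direction.
\<close>

fun walk :: "'v circuit \<Rightarrow> 'v \<Rightarrow> (branch \<times> bool) list \<Rightarrow> 'v \<Rightarrow> bool" where
  "walk C x [] y \<longleftrightarrow> x = y"
| "walk C x ((b, fwd) # ss) y \<longleftrightarrow> b \<in> branches C \<and>
     x = (if fwd then pos C b else neg C b) \<and> walk C (if fwd then neg C b else pos C b) ss y"

definition KVL :: "'v circuit \<Rightarrow> (branch \<Rightarrow> signal) \<Rightarrow> bool" where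
  "KVL C V \<longleftrightarrow>
     (\<forall>x ss. walk C x ss x \<longrightarrow> (\<Sum>(b, fwd)\<leftarrow>ss. if fwd then V b else - V b) = 0)"

definition transformer_law ::
  "real mat \<Rightarrow> signal vec \<Rightarrow> signal vec \<Rightarrow> signal vec \<Rightarrow> signal vec \<Rightarrow> bool" where
  "transformer_law K v1 i1 v2 i2 \<longleftrightarrow>
     i1 @\<^sub>v v2 =
       tensor_Id (four_block_mat (0\<^sub>m (dim_col K) (dim_col K)) (transpose_mat K)
                                 (- K) (0\<^sub>m (dim_row K) (dim_row K)))
         (v1 @\<^sub>v i2)"

definition box_laws :: "'v circuit \<Rightarrow> (branch \<Rightarrow> signal) \<Rightarrow> (branch \<Rightarrow> signal) \<Rightarrow> bool" where
  "box_laws C I V \<longleftrightarrow> KCL C I \<and> KVL C V \<and>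
     (\<forall>w<num_wires C. V (Wire w) = 0) \<and>
     (\<forall>l<length (transformers C).
        let K = transformers C ! l; a = dim_col K; b = dim_row K in
          transformer_law K
            (Matrix.vec a (\<lambda>j. V (Winding l j))) (Matrix.vec a (\<lambda>j. I (Winding l j)))
            (Matrix.vec b (\<lambda>j. V (Winding l (a + j)))) (Matrix.vec b (\<lambda>j. I (Winding l (a + j)))))"

text \<open>
  All pairs of terminal pair currents and voltages for which the wires and transformers admit
  currents and voltages that comply with the laws of the box.
\<close>

definition behavior :: "real \<Rightarrow> 'v circuit \<Rightarrow> (signal vec \<times> signal vec) set" where
  "behavior T C = {(\<iota>, \<nu>). \<exists>I V.
     (\<forall>b\<in>branches C. I b \<in> L2T T \<and> V b \<in> L2T T) \<and>
     box_laws C I V \<and>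
     (\<forall>j<length (elements C).
        (I (Terminals (num_ports C + j)), V (Terminals (num_ports C + j))) \<in> impedance (elements C ! j)) \<and>
     \<iota> = Matrix.vec (num_pairs C) (\<lambda>k. I (Terminals k)) \<and>
     \<nu> = Matrix.vec (num_pairs C) (\<lambda>k. V (Terminals k))}"

text \<open>
  Sub-vectors of \<open>\<iota>\<close> and \<open>\<nu>\<close> (called \<open>i\<close> and \<open>v\<close> here). The set \<open>S\<close> consists of the driving points
  that are excited by a current, the list \<open>es\<close> of element indices picks element signals.
\<close>

definition excitation :: "nat \<Rightarrow> nat set \<Rightarrow> signal vec \<Rightarrow> signal vec \<Rightarrow> signal vec" where
  "excitation m S i v = Matrix.vec m (\<lambda>k. if k \<in> S then i $ k else v $ k)"

definition response :: "nat \<Rightarrow> nat set \<Rightarrow> signal vec \<Rightarrow> signal vec \<Rightarrow> signal vec" where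
  "response m S i v = Matrix.vec m (\<lambda>k. if k \<in> S then v $ k else i $ k)"

definition element_part :: "nat \<Rightarrow> nat list \<Rightarrow> signal vec \<Rightarrow> signal vec" where
  "element_part m es x = Matrix.vec (length es) (\<lambda>j. x $ (m + es ! j))"

end

theory Submission
  imports Defs
begin

text \<open>
  The laws of the box constrain currents and voltages separately: Kirchhoff's current law and
  \<open>i\<^sub>1 = K\<^sup>T i\<^sub>2\<close> involve currents only, Kirchhoff's voltage law and \<open>v\<^sub>2 = - K v\<^sub>1\<close> voltages only.
  Moreover, by Tellegen's theorem together with the power balance of the transformers, the
  admissible currents and the admissible voltages at the terminal pairs are orthogonal complements.
  Choose a set \<open>F\<close> of terminal pairs whose voltages are free coordinates on the space of voltages.
  The other voltages are then \<open>\<nu>\<^sub>k = (\<Sum>l\<in>F. h k l \<nu>\<^sub>l)\<close>, and orthogonality gives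
  \<open>\<iota>\<^sub>l = - (\<Sum>k\<notin>F. h k l \<iota>\<^sub>k)\<close> for the currents in \<open>F\<close>. Taking the voltages in \<open>F\<close> and the currents
  outside \<open>F\<close> as independent variables, \<open>M\<close>, \<open>B\<^sub>R\<close>, \<open>B\<^sub>G\<close> and \<open>D\<close> are blocks of this skew
  symmetric system, whose current-current and voltage-voltage blocks are zero.
\<close>

section \<open>Coordinates on a subspace\<close>

definition linear_subspace :: "('b \<Rightarrow> real) set \<Rightarrow> bool" where
  "linear_subspace W \<longleftrightarrow>
     (\<lambda>b. 0) \<in> W \<and> (\<forall>x\<in>W. \<forall>y\<in>W. \<forall>c. (\<lambda>b. x b + c * y b) \<in> W)"

lemma linear_subspace_add_scaled:
  "linear_subspace W \<Longrightarrow> x \<in> W \<Longrightarrow> y \<in> W \<Longrightarrow> (\<lambda>b. x b + c * y b) \<in> W"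
  by (simp add: linear_subspace_def)

lemma linear_subspace_sum:
  assumes "linear_subspace W" "finite S" "\<And>s. s \<in> S \<Longrightarrow> a s \<in> W"
  shows "(\<lambda>b. \<Sum>s\<in>S. c s * a s b) \<in> W"
  using assms(2,3)
proof (induction S)
  case empty
  then show ?case using assms(1) by (simp add: linear_subspace_def)
next
  case (insert s S)
  then have "(\<lambda>b. (\<Sum>s\<in>S. c s * a s b) + c s * a s b) \<in> W"
    by (intro linear_subspace_add_scaled[OF assms(1)]) auto
  then show ?case using insert by (simp add: add.commute)
qed

text \<open>Restriction of \<open>W\<close> to \<open>S\<close> is onto. For finite \<open>S\<close>
  and a subspace \<open>W\<close> this is linear independence of the coordinate functionals indexed
  by \<open>S\<close>.\<close>

definition free_coordinates :: "('b \<Rightarrow> real) set \<Rightarrow> 'b set \<Rightarrow> bool" where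
  "free_coordinates W S \<longleftrightarrow> (\<forall>f. \<exists>w\<in>W. \<forall>s\<in>S. w s = f s)"

text \<open>For a subspace, testing at zero suffices: vectors of \<open>W\<close> that agree on
  \<open>S\<close> then agree on \<open>B\<close>.\<close>

definition determining_coordinates :: "('b \<Rightarrow> real) set \<Rightarrow> 'b set \<Rightarrow> 'b set \<Rightarrow> bool" where
  "determining_coordinates W S B \<longleftrightarrow> (\<forall>w\<in>W. (\<forall>s\<in>S. w s = 0) \<longrightarrow> (\<forall>b\<in>B. w b = 0))"

lemma determining_coordinatesD:
  "determining_coordinates W S B \<Longrightarrow> w \<in> W \<Longrightarrow> (\<And>s. s \<in> S \<Longrightarrow> w s = 0) \<Longrightarrow> b \<in> B \<Longrightarrow> w b = 0"
  by (simp add: determining_coordinates_def)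

text \<open>Basis extension: a maximal free set between \<open>S\<^sub>0\<close> and
  \<open>B\<close> works. If some \<open>w\<close> in \<open>W\<close> vanished on \<open>S\<close>
  but not at \<open>b\<close>, adding a multiple of \<open>w\<close> would adjust the value at
  \<open>b\<close> and keep those on \<open>S\<close>, so \<open>insert b S\<close> would be free
  too.\<close>

lemma extend_free_coordinates:
  assumes W: "linear_subspace W" and "finite B" "S\<^sub>0 \<subseteq> B" "free_coordinates W S\<^sub>0"
  obtains S where "S\<^sub>0 \<subseteq> S" "S \<subseteq> B" "free_coordinates W S" "determining_coordinates W S B"
proof -
  define F where "F = {S. S\<^sub>0 \<subseteq> S \<and> S \<subseteq> B \<and> free_coordinates W S}"
  have "finite F"
    by (rule finite_subset[of _ "Pow B"]) (use assms F_def in auto)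
  moreover have "S\<^sub>0 \<in> F" using assms by (auto simp: F_def)
  ultimately obtain S where "S \<in> F" and max: "\<And>S'. S' \<in> F \<Longrightarrow> S \<subseteq> S' \<Longrightarrow> S = S'"
    using finite_has_maximal[of F] by blast
  then have S: "S\<^sub>0 \<subseteq> S" "S \<subseteq> B" "free_coordinates W S"
    by (auto simp: F_def)
  have "w b = 0" if w: "w \<in> W" "\<forall>s\<in>S. w s = 0" and b: "b \<in> B" for w b
  proof (rule ccontr)
    assume nz: "w b \<noteq> 0"
    have "\<exists>w'\<in>W. \<forall>s\<in>insert b S. w' s = f s" for f
    proof -
      obtain x where x: "x \<in> W" "\<forall>s\<in>S. x s = f s"
        using S(3) by (auto simp: free_coordinates_def)
      show ?thesis
        using linear_subspace_add_scaled[OF W x(1) w(1), of "(f b - x b) / w b"] x w nz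
        by (intro bexI[where x = "\<lambda>t. x t + (f b - x b) / w b * w t"]) auto
    qed
    then have "insert b S \<in> F"
      using S(1,2) b by (auto simp: free_coordinates_def F_def)
    then have "b \<in> S"
      using max by blast
    then show False using w nz by auto
  qed
  then show ?thesis
    by (intro that[OF S]) (simp add: determining_coordinates_def)
qed

text \<open>
  Eliminating the coordinates in \<open>Q\<close> first is what makes the basis vectors of the remaining free
  coordinates vanish on \<open>Q\<close>. They then span the vectors of \<open>W\<close> that are supported outside \<open>Q\<close>,
  and the coordinates in \<open>Q\<close> do not enter the relations between the others.
\<close>

definition adapted_basis ::
  "('b \<Rightarrow> real) set \<Rightarrow> 'b set \<Rightarrow> 'b set \<Rightarrow> 'b set \<Rightarrow> ('b \<Rightarrow> 'b \<Rightarrow> real) \<Rightarrow> bool" where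
  "adapted_basis W B Q S a \<longleftrightarrow> S \<subseteq> B \<and> (\<forall>s\<in>S. a s \<in> W) \<and>
     (\<forall>s\<in>S. \<forall>t\<in>S. a s t = (if s = t then 1 else 0)) \<and>
     (\<forall>w\<in>W. \<forall>b\<in>B. w b = (\<Sum>s\<in>S. w s * a s b)) \<and>
     (\<forall>s\<in>S - Q. \<forall>b\<in>Q. a s b = 0)"

text \<open>Two stages: a free set that determines \<open>Q\<close> is chosen first and then
  enlarged to one that determines \<open>B\<close>; \<open>a\<close> is the dual basis.\<close>

lemma adapted_basis_exists:
  assumes W: "linear_subspace W" and B: "finite B" and "Q \<subseteq> B"
  shows "\<exists>S a. adapted_basis W B Q S a"
proof -
  have free: "free_coordinates W {}"
    using W by (auto simp: free_coordinates_def linear_subspace_def)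
  have "finite Q"
    using B \<open>Q \<subseteq> B\<close> by (rule rev_finite_subset)
  then obtain S\<^sub>Q where SQ: "{} \<subseteq> S\<^sub>Q" "S\<^sub>Q \<subseteq> Q" "free_coordinates W S\<^sub>Q"
    and detQ: "determining_coordinates W S\<^sub>Q Q"
    using extend_free_coordinates[OF W _ empty_subsetI free] by blast
  have "S\<^sub>Q \<subseteq> B"
    using SQ(2) \<open>Q \<subseteq> B\<close> by (rule subset_trans)
  then obtain S where S: "S\<^sub>Q \<subseteq> S" "S \<subseteq> B" "free_coordinates W S"
    and det: "determining_coordinates W S B"
    using extend_free_coordinates[OF W B _ SQ(3)] by blast
  have fin: "finite S"
    using B S(2) by (rule rev_finite_subset)
  have "\<forall>s. \<exists>w\<in>W. \<forall>t\<in>S. w t = (if s = t then 1 else 0)"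
    using S(3) by (auto simp: free_coordinates_def)
  then obtain a where aW: "\<And>s. a s \<in> W"
    and a: "\<And>s t. t \<in> S \<Longrightarrow> a s t = (if s = t then 1 else 0)"
    by metis
  have "w b = (\<Sum>s\<in>S. w s * a s b)" if "w \<in> W" "b \<in> B" for w b
  proof -
    \<comment> \<open>\<open>w\<close> minus its expansion lies in \<open>W\<close> and vanishes on
      \<open>S\<close>, hence on \<open>B\<close>.\<close>
    have "(\<lambda>b. w b + (-1) * (\<Sum>s\<in>S. w s * a s b)) \<in> W"
      using that aW by (intro linear_subspace_add_scaled[OF W] linear_subspace_sum[OF W fin]) auto
    from determining_coordinatesD[OF det this _ that(2)] show ?thesis
      using fin by (simp add: a if_distrib cong: if_cong)
  qed
  \<comment> \<open>Within \<open>S\<close> the vector \<open>a s\<close> is nonzero only at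
    \<open>s\<close>, which lies outside \<open>Q\<close>. So it vanishes on
    \<open>S\<^sub>Q\<close>, and this set determines \<open>Q\<close>.\<close>
  moreover have "a s b = 0" if s: "s \<in> S - Q" and "b \<in> Q" for s b
  proof (rule determining_coordinatesD[OF detQ aW _ \<open>b \<in> Q\<close>])
    show "a s t = 0" if "t \<in> S\<^sub>Q" for t
    proof -
      have "t \<in> S" "s \<noteq> t"
        using that s SQ(2) S(1) by auto
      then show ?thesis by (simp add: a)
    qed
  qed
  ultimately have "adapted_basis W B Q S a"
    unfolding adapted_basis_def using S(2) aW a by blast
  then show ?thesis by blast
qed

section \<open>Signal vectors\<close>

lemma sum_lessThan_add:
  fixes f :: "nat \<Rightarrow> 'a::comm_monoid_add"
  shows "(\<Sum>k<a+b. f k) = (\<Sum>k<a. f k) + (\<Sum>k<b. f (a + k))"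
  by (induction b) (auto simp: algebra_simps)

lemma all_less_add_iff: "(\<forall>j<a + b. P j) \<longleftrightarrow> (\<forall>j<a. P j) \<and> (\<forall>j<b. P (a + j))" for a b :: nat
  by (metis add.commute add_diff_inverse_nat nat_add_left_cancel_less trans_less_add1)

lemma dim_vec_tensor_Id [simp]: "dim_vec (tensor_Id A x) = dim_row A"
  by (simp add: tensor_Id_def)

text \<open>The transformer law and the circuit equations have a block matrix of the same shape,
  with \<open>K\<close> or \<open>M\<close> in it; both are evaluated through these rows.\<close>

lemma tensor_Id_skew_block:
  fixes K :: "real mat"
  assumes K: "K \<in> carrier_mat b a" and x: "x \<in> carrier_vec a" and y: "y \<in> carrier_vec b"
  defines "J \<equiv> four_block_mat (0\<^sub>m a a) (transpose_mat K) (- K) (0\<^sub>m b b)"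
  shows "dim_row J = a + b"
    and "j < a \<Longrightarrow> tensor_Id J (x @\<^sub>v y) $ j = (\<Sum>k<b. K $$ (k, j) *\<^sub>R y $ k)"
    and "j < b \<Longrightarrow> tensor_Id J (x @\<^sub>v y) $ (a + j) = - (\<Sum>k<a. K $$ (j, k) *\<^sub>R x $ k)"
proof -
  have dims: "dim_row J = a + b" "dim_col J = a + b"
    using K by (auto simp: J_def)
  show "dim_row J = a + b" by (rule dims)
  show "tensor_Id J (x @\<^sub>v y) $ j = (\<Sum>k<b. K $$ (k, j) *\<^sub>R y $ k)" if "j < a"
    using that K x y unfolding tensor_Id_def dims sum_lessThan_add
    by (auto simp: J_def intro!: sum.cong)
  show "tensor_Id J (x @\<^sub>v y) $ (a + j) = - (\<Sum>k<a. K $$ (j, k) *\<^sub>R x $ k)" if "j < b"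
    using that K x y unfolding tensor_Id_def dims sum_lessThan_add sum_negf[symmetric]
    by (auto simp: J_def intro!: sum.cong)
qed

lemma transformer_law_iff:
  "transformer_law K (Matrix.vec (dim_col K) v1) (Matrix.vec (dim_col K) i1)
      (Matrix.vec (dim_row K) v2) (Matrix.vec (dim_row K) i2) \<longleftrightarrow>
    (\<forall>j<dim_col K. i1 j = (\<Sum>k<dim_row K. K $$ (k, j) *\<^sub>R i2 k)) \<and>
    (\<forall>j<dim_row K. v2 j = - (\<Sum>k<dim_col K. K $$ (j, k) *\<^sub>R v1 k))"
  using tensor_Id_skew_block[of K "dim_row K" "dim_col K"
      "Matrix.vec (dim_col K) v1" "Matrix.vec (dim_row K) i2"]
  unfolding transformer_law_def vec_eq_iff
  by (simp add: all_less_add_iff del: index_mat_four_block)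

section \<open>Closure of the signal space under linear combinations\<close>

lemma zero_in_L2T: "0 \<in> L2T T"
  unfolding L2T_def mem_Collect_eq by transfer simp

lemma add_in_L2T: "x \<in> L2T T \<Longrightarrow> y \<in> L2T T \<Longrightarrow> x + y \<in> L2T T"
  unfolding L2T_def mem_Collect_eq
proof transfer
  fix f g :: "real \<Rightarrow> real" and T :: real
  assume "AE t in lebesgue. t \<notin> {0..T} \<longrightarrow> f t = 0" "AE t in lebesgue. t \<notin> {0..T} \<longrightarrow> g t = 0"
  then show "AE t in lebesgue. t \<notin> {0..T} \<longrightarrow> f t + g t = 0"
    by eventually_elim simp
qed

lemma scaleR_in_L2T: "x \<in> L2T T \<Longrightarrow> c *\<^sub>R x \<in> L2T T"
  unfolding L2T_def mem_Collect_eq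
proof transfer
  fix f :: "real \<Rightarrow> real" and c T :: real
  assume "AE t in lebesgue. t \<notin> {0..T} \<longrightarrow> f t = 0"
  then show "AE t in lebesgue. t \<notin> {0..T} \<longrightarrow> c * f t = 0"
    by eventually_elim simp
qed

lemma sum_in_L2T: "(\<And>s. s \<in> S \<Longrightarrow> f s \<in> L2T T) \<Longrightarrow> sum f S \<in> L2T T"
  by (induction S rule: infinite_finite_induct) (auto intro: zero_in_L2T add_in_L2T)

lemma uminus_in_L2T: "x \<in> L2T T \<Longrightarrow> - x \<in> L2T T"
  using scaleR_in_L2T[of x T "-1"] by simp

section \<open>The laws of the box\<close>

definition current_laws :: "'v circuit \<Rightarrow> (branch \<Rightarrow> signal) \<Rightarrow> bool" where
  "current_laws C I \<longleftrightarrow> KCL C I \<and>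
     (\<forall>l<length (transformers C). let K = transformers C ! l in
        \<forall>j<dim_col K. I (Winding l j) =
          (\<Sum>k<dim_row K. K $$ (k, j) *\<^sub>R I (Winding l (dim_col K + k))))"

definition voltage_laws :: "'v circuit \<Rightarrow> (branch \<Rightarrow> signal) \<Rightarrow> bool" where
  "voltage_laws C V \<longleftrightarrow> KVL C V \<and> (\<forall>w<num_wires C. V (Wire w) = 0) \<and>
     (\<forall>l<length (transformers C). let K = transformers C ! l in
        \<forall>j<dim_row K. V (Winding l (dim_col K + j)) =
          - (\<Sum>k<dim_col K. K $$ (j, k) *\<^sub>R V (Winding l k)))"

text \<open>The diagonal blocks of a transformer matrix are zero, so each of its rows relates
  currents to currents or voltages to voltages.\<close>

lemma box_laws_iff: "box_laws C I V \<longleftrightarrow> current_laws C I \<and> voltage_laws C V"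
  by (auto simp: box_laws_def current_laws_def voltage_laws_def Let_def transformer_law_iff)

text \<open>Real coefficients instead of signals. The values at the first ports of a transformer are
  arbitrary multipliers for its current equations; the values at the second ports are the
  coefficients that the second port currents then receive.\<close>

definition winding_voltages :: "'v circuit \<Rightarrow> (branch \<Rightarrow> real) set" where
  "winding_voltages C = {n. (\<forall>k. n (Terminals k) = 0) \<and> (\<forall>w. n (Wire w) = 0) \<and>
     (\<forall>l<length (transformers C). let K = transformers C ! l in
        \<forall>j<dim_row K. n (Winding l (dim_col K + j)) =
          - (\<Sum>k<dim_col K. K $$ (j, k) * n (Winding l k)))}"

text \<open>
  Potential differences are the linear combinations of the equations of the current law, and the
  winding voltages those of the current equations \<open>i\<^sub>1 = K\<^sup>T i\<^sub>2\<close> of the transformers. So this set of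
  coefficient vectors annihilates exactly the admissible currents, while an element that vanishes
  off the terminal pairs is the terminal part of an admissible voltage.
\<close>

definition current_constraints :: "'v circuit \<Rightarrow> (branch \<Rightarrow> real) set" where
  "current_constraints C = {a. \<exists>\<phi>. \<exists>n\<in>winding_voltages C.
     \<forall>b\<in>branches C. a b = \<phi> (pos C b) - \<phi> (neg C b) + n b}"

lemma winding_voltages_add_scaled:
  assumes "n \<in> winding_voltages C" "n' \<in> winding_voltages C"
  shows "(\<lambda>b. n b + c * n' b) \<in> winding_voltages C"
  using assms
  by (auto simp: winding_voltages_def Let_def algebra_simps sum.distrib sum_distrib_left)

lemma linear_subspace_current_constraints: "linear_subspace (current_constraints C)"
  unfolding linear_subspace_def
proof (intro conjI ballI allI)
  show "(\<lambda>b. 0) \<in> current_constraints C"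
    unfolding current_constraints_def winding_voltages_def
    by (rule CollectI, rule exI[of _ "\<lambda>_. 0"], rule bexI[of _ "\<lambda>_. 0"]) auto
next
  fix x y and c :: real
  assume "x \<in> current_constraints C" "y \<in> current_constraints C"
  then obtain \<phi> n \<psi> n' where n: "n \<in> winding_voltages C" "n' \<in> winding_voltages C"
    and eq: "\<forall>b\<in>branches C. x b = \<phi> (pos C b) - \<phi> (neg C b) + n b"
    "\<forall>b\<in>branches C. y b = \<psi> (pos C b) - \<psi> (neg C b) + n' b"
    unfolding current_constraints_def by blast
  show "(\<lambda>b. x b + c * y b) \<in> current_constraints C"
    unfolding current_constraints_def
    by (rule CollectI, rule exI[of _ "\<lambda>x. \<phi> x + c * \<psi> x"],
        rule bexI[OF _ winding_voltages_add_scaled[OF n, of c]])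
      (simp add: eq algebra_simps)
qed

section \<open>Currents and the coefficient vectors that annihilate them\<close>

lemma finite_branches: "finite (branches C)"
proof -
  have "{Winding l j | l j. l < length (transformers C) \<and>
        j < dim_col (transformers C ! l) + dim_row (transformers C ! l)} =
    (\<Union>l<length (transformers C). Winding l ` {..<dim_col (transformers C ! l) + dim_row (transformers C ! l)})"
    by auto
  then show ?thesis by (simp add: branches_def)
qed

lemma sum_branches:
  fixes f :: "branch \<Rightarrow> 'a::comm_monoid_add"
  shows "sum f (branches C) = (\<Sum>k<num_pairs C. f (Terminals k)) + (\<Sum>w<num_wires C. f (Wire w)) +
    (\<Sum>l<length (transformers C). let K = transformers C ! l in
       (\<Sum>j<dim_col K. f (Winding l j)) + (\<Sum>j<dim_row K. f (Winding l (dim_col K + j))))"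
proof -
  define N where "N l = dim_col (transformers C ! l) + dim_row (transformers C ! l)" for l
  let ?W = "\<Union>l<length (transformers C). Winding l ` {..<N l}"
  have "branches C = Terminals ` {..<num_pairs C} \<union> Wire ` {..<num_wires C} \<union> ?W"
    by (auto simp: branches_def N_def)
  then have "sum f (branches C) =
      sum f (Terminals ` {..<num_pairs C} \<union> Wire ` {..<num_wires C}) + sum f ?W"
    by (simp only:) (intro sum.union_disjoint; auto)
  also have "sum f (Terminals ` {..<num_pairs C} \<union> Wire ` {..<num_wires C}) =
      sum f (Terminals ` {..<num_pairs C}) + sum f (Wire ` {..<num_wires C})"
    by (intro sum.union_disjoint) auto
  also have "sum f (Terminals ` {..<num_pairs C}) = (\<Sum>k<num_pairs C. f (Terminals k))"
    by (subst sum.reindex) (auto simp: inj_on_def)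
  also have "sum f (Wire ` {..<num_wires C}) = (\<Sum>w<num_wires C. f (Wire w))"
    by (subst sum.reindex) (auto simp: inj_on_def)
  also have "sum f ?W = (\<Sum>l<length (transformers C). sum f (Winding l ` {..<N l}))"
    by (intro sum.UNION_disjoint) auto
  also have "\<dots> = (\<Sum>l<length (transformers C). \<Sum>j<N l. f (Winding l j))"
    by (intro sum.cong refl, subst sum.reindex) (auto simp: inj_on_def)
  finally show ?thesis
    by (simp add: N_def Let_def sum_lessThan_add)
qed

text \<open>Tellegen's theorem for currents: weighting the balance at each vertex by a potential and
  regrouping by branches gives the pairing with the potential differences.\<close>

lemma KCL_iff:
  fixes C :: "'v circuit"
  shows "KCL C I \<longleftrightarrow> (\<forall>\<phi>. (\<Sum>b\<in>branches C. (\<phi> (pos C b) - \<phi> (neg C b)) *\<^sub>R I b) = 0)"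
proof
  assume kcl: "KCL C I"
  have "(\<Sum>b\<in>branches C. \<phi> (pos C b) *\<^sub>R I b) = (\<Sum>b\<in>branches C. \<phi> (neg C b) *\<^sub>R I b)" for \<phi>
  proof -
    \<comment> \<open>The vertex type may be infinite, but only finitely many vertices are end
      points of branches.\<close>
    let ?X = "pos C ` branches C \<union> neg C ` branches C"
    have group: "(\<Sum>b\<in>branches C. \<phi> (p b) *\<^sub>R I b) =
        (\<Sum>x\<in>?X. \<phi> x *\<^sub>R (\<Sum>b | b \<in> branches C \<and> p b = x. I b))"
      if "p ` branches C \<subseteq> ?X" for p
    proof -
      have "finite ?X"
        using finite_branches[of C] by simp
      from sum.group[OF finite_branches this that, of "\<lambda>b. \<phi> (p b) *\<^sub>R I b"] show ?thesis
        unfolding scaleR_sum_right by (elim subst) (intro sum.cong refl, simp)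
    qed
    show ?thesis
      using kcl by (simp add: group[of "pos C"] group[of "neg C"] KCL_def)
  qed
  then show "\<forall>\<phi>. (\<Sum>b\<in>branches C. (\<phi> (pos C b) - \<phi> (neg C b)) *\<^sub>R I b) = 0"
    by (simp add: scaleR_left_diff_distrib sum_subtractf)
next
  assume *: "\<forall>\<phi>. (\<Sum>b\<in>branches C. (\<phi> (pos C b) - \<phi> (neg C b)) *\<^sub>R I b) = 0"
  show "KCL C I"
    unfolding KCL_def
  proof
    fix x :: 'v
    have ind: "(\<Sum>b\<in>branches C. (if p b = x then 1 else 0) *\<^sub>R I b) =
        (\<Sum>b | b \<in> branches C \<and> p b = x. I b)" for p
      by (simp add: sum.inter_filter[OF finite_branches] if_distrib[of "\<lambda>c. c *\<^sub>R _"] cong: if_cong)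
    \<comment> \<open>The indicator of \<open>x\<close> as potential isolates the balance at
      \<open>x\<close>.\<close>
    show "(\<Sum>b | b \<in> branches C \<and> pos C b = x. I b) = (\<Sum>b | b \<in> branches C \<and> neg C b = x. I b)"
      using *[rule_format, of "\<lambda>y. if y = x then 1 else 0"]
      by (simp only: scaleR_left_diff_distrib sum_subtractf ind) simp
  qed
qed

text \<open>Substituting the values of \<open>n\<close> at the second ports and exchanging the two
  sums collects, for each first port, the defect of its current equation.\<close>

lemma sum_winding_voltages:
  fixes I :: "branch \<Rightarrow> signal"
  assumes n: "n \<in> winding_voltages C"
  shows "(\<Sum>b\<in>branches C. n b *\<^sub>R I b) =
    (\<Sum>l<length (transformers C). let K = transformers C ! l in
       \<Sum>j<dim_col K. n (Winding l j) *\<^sub>R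
         (I (Winding l j) - (\<Sum>k<dim_row K. K $$ (k, j) *\<^sub>R I (Winding l (dim_col K + k)))))"
proof -
  have "(\<Sum>j<dim_col K. n (Winding l j) *\<^sub>R I (Winding l j)) +
      (\<Sum>j<dim_row K. n (Winding l (dim_col K + j)) *\<^sub>R I (Winding l (dim_col K + j))) =
      (\<Sum>j<dim_col K. n (Winding l j) *\<^sub>R
         (I (Winding l j) - (\<Sum>k<dim_row K. K $$ (k, j) *\<^sub>R I (Winding l (dim_col K + k)))))"
    if l: "l < length (transformers C)" and K: "K = transformers C ! l" for l K
  proof -
    have "n (Winding l (dim_col K + j)) = - (\<Sum>k<dim_col K. K $$ (j, k) * n (Winding l k))"
      if "j < dim_row K" for j
      using n l K that by (auto simp: winding_voltages_def Let_def)
    then have "(\<Sum>j<dim_row K. n (Winding l (dim_col K + j)) *\<^sub>R I (Winding l (dim_col K + j))) =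
        - (\<Sum>j<dim_row K. \<Sum>k<dim_col K. (K $$ (j, k) * n (Winding l k)) *\<^sub>R I (Winding l (dim_col K + j)))"
      by (simp add: scaleR_sum_left sum_negf)
    also have "\<dots> = - (\<Sum>k<dim_col K. n (Winding l k) *\<^sub>R
        (\<Sum>j<dim_row K. K $$ (j, k) *\<^sub>R I (Winding l (dim_col K + j))))"
      by (subst sum.swap) (simp add: scaleR_sum_right mult.commute)
    finally show ?thesis
      by (simp add: scaleR_right_diff_distrib sum_subtractf)
  qed
  moreover have "n (Terminals k) = 0" "n (Wire w) = 0" for k w
    using n by (auto simp: winding_voltages_def)
  ultimately show ?thesis
    by (simp add: sum_branches Let_def)
qed

text \<open>Duality for currents: constraint vectors give combinations of the laws, and conversely
  each single law is the pairing with a suitable constraint vector.\<close>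

lemma current_laws_iff:
  "current_laws C I \<longleftrightarrow> (\<forall>a\<in>current_constraints C. (\<Sum>b\<in>branches C. a b *\<^sub>R I b) = 0)"
proof
  assume I: "current_laws C I"
  show "\<forall>a\<in>current_constraints C. (\<Sum>b\<in>branches C. a b *\<^sub>R I b) = 0"
  proof
    fix a assume "a \<in> current_constraints C"
    then obtain \<phi> n where n: "n \<in> winding_voltages C"
      and a: "\<forall>b\<in>branches C. a b = \<phi> (pos C b) - \<phi> (neg C b) + n b"
      unfolding current_constraints_def by blast
    have "(\<Sum>b\<in>branches C. a b *\<^sub>R I b) =
        (\<Sum>b\<in>branches C. (\<phi> (pos C b) - \<phi> (neg C b)) *\<^sub>R I b) + (\<Sum>b\<in>branches C. n b *\<^sub>R I b)"
      by (simp add: a scaleR_left_distrib sum.distrib)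
    moreover have "(\<Sum>b\<in>branches C. (\<phi> (pos C b) - \<phi> (neg C b)) *\<^sub>R I b) = 0"
      using I KCL_iff[of C I] by (simp add: current_laws_def)
    moreover have "(\<Sum>b\<in>branches C. n b *\<^sub>R I b) = 0"
      using I by (simp add: sum_winding_voltages[OF n] current_laws_def Let_def)
    ultimately show "(\<Sum>b\<in>branches C. a b *\<^sub>R I b) = 0"
      by simp
  qed
next
  assume *: "\<forall>a\<in>current_constraints C. (\<Sum>b\<in>branches C. a b *\<^sub>R I b) = 0"
  have zero: "(\<lambda>_. 0) \<in> winding_voltages C"
    by (simp add: winding_voltages_def)
  have "KCL C I"
    unfolding KCL_iff
  proof
    fix \<phi>
    have "(\<lambda>b. \<phi> (pos C b) - \<phi> (neg C b)) \<in> current_constraints C"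
      unfolding current_constraints_def
      by (rule CollectI, rule exI[of _ \<phi>], rule bexI[OF _ zero]) simp
    from bspec[OF * this] show "(\<Sum>b\<in>branches C. (\<phi> (pos C b) - \<phi> (neg C b)) *\<^sub>R I b) = 0"
      by simp
  qed
  moreover have "I (Winding l j) = (\<Sum>k<dim_row K. K $$ (k, j) *\<^sub>R I (Winding l (dim_col K + k)))"
    if l: "l < length (transformers C)" and K: "K = transformers C ! l" and j: "j < dim_col K" for l K j
  proof -
    \<comment> \<open>Unit voltage at the first port \<open>j\<close> of transformer
      \<open>l\<close>, zero at its other first ports, and the induced voltages at its second ports.
      Pairing with it yields the current equation of port \<open>j\<close>.\<close>
    define n where "n b = (case b of Winding l' i \<Rightarrow>
      if l' = l then if i < dim_col K then if i = j then 1 else 0 else - K $$ (i - dim_col K, j) else 0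
      | _ \<Rightarrow> 0)" for b
    have n: "n \<in> winding_voltages C"
      using j K by (auto simp: winding_voltages_def n_def Let_def if_distrib[of "(*) _"] cong: if_cong)
    have "n \<in> current_constraints C"
      unfolding current_constraints_def
      by (rule CollectI, rule exI[of _ "\<lambda>_. 0"], rule bexI[OF _ n]) simp
    then have "0 = (\<Sum>b\<in>branches C. n b *\<^sub>R I b)"
      using * by simp
    also have "\<dots> = (\<Sum>l'<length (transformers C). if l' = l then
        I (Winding l j) - (\<Sum>k<dim_row K. K $$ (k, j) *\<^sub>R I (Winding l (dim_col K + k))) else 0)"
      unfolding sum_winding_voltages[OF n]
      using j K by (intro sum.cong refl)
        (auto simp: Let_def n_def if_distrib[of "\<lambda>c. c *\<^sub>R _"] cong: if_cong)
    finally show ?thesis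
      using l by simp
  qed
  ultimately show "current_laws C I"
    by (simp add: current_laws_def Let_def)
qed


section \<open>Walks and potentials\<close>

fun walk_voltage :: "(branch \<Rightarrow> signal) \<Rightarrow> (branch \<times> bool) list \<Rightarrow> signal" where
  "walk_voltage V [] = 0"
| "walk_voltage V ((b, fwd) # ss) = (if fwd then V b else - V b) + walk_voltage V ss"

lemma walk_voltage_eq: "(\<Sum>(b, fwd)\<leftarrow>ss. if fwd then V b else - V b) = walk_voltage V ss"
  by (induction V ss rule: walk_voltage.induct) auto

lemma walk_voltage_append: "walk_voltage V (ss @ ts) = walk_voltage V ss + walk_voltage V ts"
  by (induction V ss rule: walk_voltage.induct) auto

lemma walk_append: "walk C x ss y \<Longrightarrow> walk C y ts z \<Longrightarrow> walk C x (ss @ ts) z"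
  by (induction C x ss y rule: walk.induct) auto

definition reverse_walk :: "(branch \<times> bool) list \<Rightarrow> (branch \<times> bool) list" where
  "reverse_walk ss = rev (map (\<lambda>(b, fwd). (b, \<not> fwd)) ss)"

lemma walk_reverse: "walk C x ss y \<Longrightarrow> walk C y (reverse_walk ss) x"
  by (induction C x ss y rule: walk.induct)
    (auto simp: reverse_walk_def intro!: walk_append split: if_splits)

lemma walk_voltage_reverse: "walk_voltage V (reverse_walk ss) = - walk_voltage V ss"
  by (induction V ss rule: walk_voltage.induct) (auto simp: reverse_walk_def walk_voltage_append)

text \<open>Along a walk, potential differences telescope. Conversely, the potential of a vertex is
  the voltage along a chosen walk to a root of its connected component.\<close>

lemma KVL_iff:
  fixes C :: "'v circuit"
  shows "KVL C V \<longleftrightarrow> (\<exists>\<phi>. \<forall>b\<in>branches C. V b = \<phi> (pos C b) - \<phi> (neg C b))"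
proof
  assume "\<exists>\<phi>. \<forall>b\<in>branches C. V b = \<phi> (pos C b) - \<phi> (neg C b)"
  then obtain \<phi> where \<phi>: "\<forall>b\<in>branches C. V b = \<phi> (pos C b) - \<phi> (neg C b)"
    by blast
  have "walk C x ss y \<Longrightarrow> walk_voltage V ss = \<phi> x - \<phi> y" for x ss y
    by (induction ss arbitrary: x) (use \<phi> in \<open>auto split: if_splits\<close>)
  then show "KVL C V"
    by (auto simp: KVL_def walk_voltage_eq)
next
  assume kvl: "KVL C V"
  \<comment> \<open>The choice depends only on the set of vertices reachable from \<open>x\<close>,
    so both ends of a branch get the same root.\<close>
  define root where "root x = (SOME y. \<exists>ss. walk C x ss y)" for x
  define path where "path x = (SOME ss. walk C x ss (root x))" for x
  have path: "walk C x (path x) (root x)" for x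
  proof -
    have "\<exists>y ss. walk C x ss y"
      by (intro exI[of _ x] exI[of _ "[]"]) simp
    then have "\<exists>ss. walk C x ss (root x)"
      unfolding root_def by (rule someI_ex)
    then show ?thesis
      unfolding path_def by (rule someI_ex)
  qed
  have "V b = walk_voltage V (path (pos C b)) - walk_voltage V (path (neg C b))"
    if b: "b \<in> branches C" for b
  proof -
    have fwd: "walk C (pos C b) [(b, True)] (neg C b)" and bwd: "walk C (neg C b) [(b, False)] (pos C b)"
      using b by auto
    have "(\<exists>ss. walk C (pos C b) ss y) = (\<exists>ss. walk C (neg C b) ss y)" for y
      using walk_append[OF fwd, of _ y] walk_append[OF bwd, of _ y] by blast
    then have root: "root (neg C b) = root (pos C b)"
      by (simp add: root_def)
    \<comment> \<open>Closed walk: across \<open>b\<close>, on to the common root, and back to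
      \<open>pos C b\<close> along its own path.\<close>
    have "walk C (pos C b) ([(b, True)] @ path (neg C b) @ reverse_walk (path (pos C b))) (pos C b)"
      using path[of "neg C b"] unfolding root
      by (intro walk_append[OF fwd] walk_append[OF _ walk_reverse[OF path]])
    then have "walk_voltage V ([(b, True)] @ path (neg C b) @ reverse_walk (path (pos C b))) = 0"
      using kvl unfolding KVL_def walk_voltage_eq by blast
    then show ?thesis
      by (simp add: walk_voltage_append walk_voltage_reverse algebra_simps eq_neg_iff_add_eq_0)
  qed
  then show "\<exists>\<phi>. \<forall>b\<in>branches C. V b = \<phi> (pos C b) - \<phi> (neg C b)"
    by (intro exI[of _ "\<lambda>x. walk_voltage V (path x)"]) blast
qed

text \<open>Pairing the potential with \<open>y\<close> gives a real potential, whose differences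
  agree with the voltages paired with \<open>y\<close>; the windings are then cancelled by an
  element of \<open>winding_voltages\<close>.\<close>

lemma terminal_voltages_in_current_constraints:
  assumes V: "voltage_laws C V"
  shows "(\<lambda>b. case b of Terminals k \<Rightarrow> inner (V b) y | _ \<Rightarrow> 0) \<in> current_constraints C"
    (is "?a \<in> _")
proof -
  obtain \<phi> where \<phi>: "\<forall>b\<in>branches C. V b = \<phi> (pos C b) - \<phi> (neg C b)"
    using V KVL_iff[of C V] by (auto simp: voltage_laws_def)
  \<comment> \<open>The voltage law of a transformer is linear and homogeneous, so it survives the
    pairing and the change of sign.\<close>
  define n where "n b = (case b of Winding l j \<Rightarrow> - inner (V b) y | _ \<Rightarrow> 0)" for b
  have n: "n \<in> winding_voltages C"
    using V by (auto simp: winding_voltages_def voltage_laws_def n_def Let_def inner_sum_left sum_negf)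
  have "?a b = inner (\<phi> (pos C b)) y - inner (\<phi> (neg C b)) y + n b" if b: "b \<in> branches C" for b
  proof -
    have "V (Wire w) = 0" if "b = Wire w" for w
      using V b that by (auto simp: voltage_laws_def branches_def)
    then have "?a b = inner (V b) y + n b"
      by (auto simp: n_def split: branch.splits)
    then show ?thesis
      using \<phi> b by (simp add: inner_diff_left)
  qed
  then show ?thesis
    unfolding current_constraints_def
    by (intro CollectI exI[of _ "\<lambda>x. inner (\<phi> x) y"] bexI[OF _ n]) blast
qed

text \<open>A converse: the potential part of a constraint vector that vanishes off the terminal
  pairs is itself a solution of the voltage laws. The weights \<open>z s\<close> turn such real
  solutions into signals.\<close>

lemma voltages_of_current_constraints:
  assumes a: "\<And>s. s \<in> S \<Longrightarrow> a s \<in> current_constraints C"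
    and zero: "\<And>s b. s \<in> S \<Longrightarrow> b \<in> branches C - range Terminals \<Longrightarrow> a s b = 0"
  obtains c where "voltage_laws C (\<lambda>b. \<Sum>s\<in>S. c s b *\<^sub>R z s)"
    "\<And>s k. s \<in> S \<Longrightarrow> Terminals k \<in> branches C \<Longrightarrow> c s (Terminals k) = a s (Terminals k)"
proof -
  have "\<forall>s\<in>S. \<exists>\<phi>. \<exists>n\<in>winding_voltages C. \<forall>b\<in>branches C. a s b = \<phi> (pos C b) - \<phi> (neg C b) + n b"
    using a by (simp add: current_constraints_def)
  then obtain \<phi> n where n: "\<And>s. s \<in> S \<Longrightarrow> n s \<in> winding_voltages C"
    and eq: "\<And>s b. s \<in> S \<Longrightarrow> b \<in> branches C \<Longrightarrow> a s b = \<phi> s (pos C b) - \<phi> s (neg C b) + n s b"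
    by metis
  define c where "c s b = \<phi> s (pos C b) - \<phi> s (neg C b)" for s b
  define V where "V b = (\<Sum>s\<in>S. c s b *\<^sub>R z s)" for b
  \<comment> \<open>Off the terminal pairs the two parts of \<open>a s\<close> cancel, so
    \<open>c s\<close> inherits the transformer relations there and vanishes on wires.\<close>
  have c: "c s b = - n s b" if "s \<in> S" "b \<in> branches C - range Terminals" for s b
    using eq[of s b] zero[OF that] that by (simp add: c_def)
  have "KVL C V"
    unfolding KVL_iff
    by (rule exI[of _ "\<lambda>x. \<Sum>s\<in>S. \<phi> s x *\<^sub>R z s"])
      (simp add: V_def c_def scaleR_left_diff_distrib sum_subtractf)
  moreover have "V (Wire w) = 0" if "w < num_wires C" for w
  proof -
    have "c s (Wire w) = 0" if "s \<in> S" for s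
      using c[OF that, of "Wire w"] n[OF that] \<open>w < num_wires C\<close>
      by (auto simp: branches_def winding_voltages_def)
    then show ?thesis by (simp add: V_def)
  qed
  moreover have "V (Winding l (dim_col K + j)) = - (\<Sum>k<dim_col K. K $$ (j, k) *\<^sub>R V (Winding l k))"
    if l: "l < length (transformers C)" and K: "K = transformers C ! l" and j: "j < dim_row K" for l K j
  proof -
    have cw: "c s (Winding l i) = - n s (Winding l i)" if "s \<in> S" "i < dim_col K + dim_row K" for s i
      using that l K by (intro c) (auto simp: branches_def)
    have "c s (Winding l (dim_col K + j)) = - (\<Sum>k<dim_col K. K $$ (j, k) * c s (Winding l k))"
      if "s \<in> S" for s
      using n[OF that] l K j by (simp add: cw that winding_voltages_def Let_def sum_negf)
    then have "V (Winding l (dim_col K + j)) =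
        - (\<Sum>s\<in>S. \<Sum>k<dim_col K. (K $$ (j, k) * c s (Winding l k)) *\<^sub>R z s)"
      by (simp add: V_def scaleR_sum_left sum_negf)
    also have "\<dots> = - (\<Sum>k<dim_col K. K $$ (j, k) *\<^sub>R V (Winding l k))"
      unfolding V_def scaleR_sum_right by (subst sum.swap) simp
    finally show ?thesis .
  qed
  ultimately have "voltage_laws C V"
    by (simp add: voltage_laws_def Let_def)
  moreover have "c s (Terminals k) = a s (Terminals k)" if "s \<in> S" "Terminals k \<in> branches C" for s k
    using eq[OF that] n[OF that(1)] by (simp add: c_def winding_voltages_def)
  ultimately show ?thesis
    unfolding V_def by (rule that)
qed

section \<open>The behavior in coordinates\<close>

text \<open>Elimination of wires and windings: \<open>Q\<close> below holds these internal branches,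
  and a basis of the constraints adapted to \<open>Q\<close> yields \<open>F\<close> and
  \<open>h\<close>. That the relations are sufficient is shown by constructing internal currents and
  voltages.\<close>

lemma behavior_coordinates:
  assumes N: "N = num_pairs C"
  obtains F h where "F \<subseteq> {..<N}"
    "behavior T C = {(\<iota>, \<nu>). \<iota> \<in> L2T_vec T N \<and> \<nu> \<in> L2T_vec T N \<and>
      (\<forall>j<length (elements C).
        (\<iota> $ (num_ports C + j), \<nu> $ (num_ports C + j)) \<in> impedance (elements C ! j)) \<and>
      (\<forall>k\<in>{..<N} - F. \<nu> $ k = (\<Sum>l\<in>F. h k l *\<^sub>R \<nu> $ l)) \<and>
      (\<forall>l\<in>F. \<iota> $ l = - (\<Sum>k\<in>{..<N} - F. h k l *\<^sub>R \<iota> $ k))}"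
proof -
  let ?B = "branches C" and ?W = "current_constraints C"
  define Q where "Q = ?B - range Terminals"
  define P where "P = Terminals ` {..<N}"
  have B: "?B = P \<union> Q" and PQ: "P \<inter> Q = {}" and finP: "finite P" and finQ: "finite Q"
    using finite_branches[of C] by (auto simp: P_def Q_def branches_def N)
  have "Q \<subseteq> ?B" by (simp add: B)
  then obtain S a where basis: "adapted_basis ?W ?B Q S a"
    using adapted_basis_exists[OF linear_subspace_current_constraints finite_branches] by blast
  have SB: "S \<subseteq> ?B" and aW: "\<And>s. s \<in> S \<Longrightarrow> a s \<in> ?W"
    and delta: "\<And>s t. s \<in> S \<Longrightarrow> t \<in> S \<Longrightarrow> a s t = (if s = t then 1 else 0)"
    using basis by (simp_all add: adapted_basis_def)
  have expand: "w b = (\<Sum>s\<in>S. w s * a s b)" if "w \<in> ?W" "b \<in> ?B" for w b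
    using basis that unfolding adapted_basis_def by blast
  have aQ: "a s b = 0" if "s \<in> S - Q" "b \<in> Q" for s b
    using basis that unfolding adapted_basis_def by blast
  \<comment> \<open>Basis coordinates at terminal pairs; the remaining ones, in
    \<open>S \<inter> Q\<close>, will fix internal currents.\<close>
  define F where "F = {k. k < N \<and> Terminals k \<in> S}"
  define h where "h k l = a (Terminals l) (Terminals k)" for k l
  have SP: "S - Q = Terminals ` F" "S \<inter> P = Terminals ` F"
    using SB PQ by (auto simp: F_def B P_def)
  have finS: "finite S"
    using SB finite_branches by (rule finite_subset)
  have sumP: "(\<Sum>b\<in>P. f b) = (\<Sum>k<N. f (Terminals k))" for f :: "branch \<Rightarrow> signal"
    unfolding P_def by (subst sum.reindex) (auto simp: inj_on_def)
  have sumF: "(\<Sum>b\<in>Terminals ` F. f b) = (\<Sum>k\<in>F. f (Terminals k))"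
    for f :: "branch \<Rightarrow> 'c::comm_monoid_add"
    by (subst sum.reindex) (auto simp: inj_on_def)
  have Fsub: "F \<subseteq> {..<N}" and finF: "finite F"
    by (auto simp: F_def)
  have h_delta: "h k l = (if k = l then 1 else 0)" if "k \<in> F" "l \<in> F" for k l
    using that delta[of "Terminals l" "Terminals k"] by (auto simp: h_def F_def)
  have TB: "Terminals k \<in> ?B" if "k < N" for k
    using that by (auto simp: branches_def N)

  \<comment> \<open>For \<open>l\<close> in \<open>F\<close> the basis vector vanishes on
    \<open>Q\<close> and is a unit vector on \<open>F\<close>, so its constraint involves terminal
    currents only.\<close>
  have sum_basis: "(\<Sum>b\<in>?B. a (Terminals l) b *\<^sub>R I b) =
      I (Terminals l) + (\<Sum>k\<in>{..<N} - F. h k l *\<^sub>R I (Terminals k))"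
    if l: "l \<in> F" for l and I :: "branch \<Rightarrow> signal"
  proof -
    have "Terminals l \<in> S - Q"
      using l SP by auto
    then have "(\<Sum>b\<in>Q. a (Terminals l) b *\<^sub>R I b) = 0"
      by (simp add: aQ)
    then have "(\<Sum>b\<in>?B. a (Terminals l) b *\<^sub>R I b) = (\<Sum>k<N. h k l *\<^sub>R I (Terminals k))"
      unfolding B by (simp add: sum.union_disjoint[OF finP finQ PQ] sumP h_def)
    also have "\<dots> = (\<Sum>k\<in>{..<N} - F. h k l *\<^sub>R I (Terminals k)) + (\<Sum>k\<in>F. h k l *\<^sub>R I (Terminals k))"
      by (rule sum.subset_diff[OF Fsub]) simp
    also have "(\<Sum>k\<in>F. h k l *\<^sub>R I (Terminals k)) = (\<Sum>k\<in>F. if k = l then I (Terminals k) else 0)"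
      using l by (intro sum.cong refl) (simp add: h_delta)
    also have "\<dots> = I (Terminals l)"
      using l finF by simp
    finally show ?thesis by simp
  qed

  have current_relation: "I (Terminals l) = - (\<Sum>k\<in>{..<N} - F. h k l *\<^sub>R I (Terminals k))"
    if I: "current_laws C I" and l: "l \<in> F" for I l
  proof -
    have "(\<Sum>b\<in>?B. a (Terminals l) b *\<^sub>R I b) = 0"
      using I l aW[of "Terminals l"] by (auto simp: current_laws_iff F_def)
    then show ?thesis
      unfolding sum_basis[OF l] by (simp add: eq_neg_iff_add_eq_0)
  qed

  have voltage_relation: "V (Terminals k) = (\<Sum>l\<in>F. h k l *\<^sub>R V (Terminals l))"
    if V: "voltage_laws C V" and k: "k < N" for V k
    \<comment> \<open>Pairing with a fixed signal \<open>y\<close> reduces the claim to real voltages.\<close>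
  proof (rule vector_eq_rdot[THEN iffD1], rule allI)
    fix y
    define w where "w b = (case b of Terminals k \<Rightarrow> inner (V b) y | _ \<Rightarrow> 0)" for b
    have w: "w \<in> ?W"
      unfolding w_def using V by (rule terminal_voltages_in_current_constraints)
    have wQ: "w b = 0" if "b \<in> Q" for b
      using that by (auto simp: w_def Q_def split: branch.splits)
    have "inner (V (Terminals k)) y = w (Terminals k)"
      by (simp add: w_def)
    also have "\<dots> = (\<Sum>s\<in>S. w s * a s (Terminals k))"
      using expand[OF w TB[OF k]] .
    also have "\<dots> = (\<Sum>s\<in>S - Q. w s * a s (Terminals k))"
      using finS wQ by (intro sum.mono_neutral_right) auto
    also have "\<dots> = inner (\<Sum>l\<in>F. h k l *\<^sub>R V (Terminals l)) y"
      unfolding SP by (simp add: sumF inner_sum_left w_def h_def mult.commute)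
    finally show "inner (V (Terminals k)) y = inner (\<Sum>l\<in>F. h k l *\<^sub>R V (Terminals l)) y" .
  qed

  have current_extension: "\<exists>I. current_laws C I \<and> (\<forall>b. I b \<in> L2T T) \<and> (\<forall>k<N. I (Terminals k) = x k)"
    if x: "\<And>k. k < N \<Longrightarrow> x k \<in> L2T T"
      and rel: "\<And>l. l \<in> F \<Longrightarrow> x l = - (\<Sum>k\<in>{..<N} - F. h k l *\<^sub>R x k)" for x
  proof -
    \<comment> \<open>Each internal branch in \<open>S\<close> carries the current that makes its
      own basis constraint hold; all other internal currents are zero. As \<open>a s\<close> is a
      unit vector on \<open>S\<close>, these choices do not interfere.\<close>
    define I where "I b = (case b of Terminals k \<Rightarrow> if k < N then x k else 0
      | _ \<Rightarrow> if b \<in> S \<inter> Q then - (\<Sum>k<N. a b (Terminals k) *\<^sub>R x k) else 0)" for b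
    have IT: "I (Terminals k) = x k" if "k < N" for k
      using that by (simp add: I_def)
    have IQ: "I b = (if b \<in> S then - (\<Sum>k<N. a b (Terminals k) *\<^sub>R x k) else 0)" if "b \<in> Q" for b
      using that by (auto simp: I_def Q_def split: branch.splits)
    have "(\<Sum>b\<in>?B. a s b *\<^sub>R I b) = 0" if s: "s \<in> S" for s
    proof (cases "s \<in> Q")
      case True
      have "(\<Sum>b\<in>Q. a s b *\<^sub>R I b) = (\<Sum>b\<in>Q. if b = s then I b else 0)"
        using s by (intro sum.cong refl) (auto simp: IQ delta)
      also have "\<dots> = - (\<Sum>k<N. a s (Terminals k) *\<^sub>R x k)"
        using True finQ s by (simp add: IQ)
      finally show ?thesis
        unfolding B by (simp add: sum.union_disjoint[OF finP finQ PQ] sumP IT)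
    next
      case False
      then obtain l where l: "l \<in> F" "s = Terminals l"
        using s SP by auto
      then have "l < N" using Fsub by auto
      have "(\<Sum>k\<in>{..<N} - F. h k l *\<^sub>R I (Terminals k)) = (\<Sum>k\<in>{..<N} - F. h k l *\<^sub>R x k)"
        by (intro sum.cong refl) (simp add: IT)
      then show ?thesis
        using rel[OF l(1)] IT[OF \<open>l < N\<close>] by (simp add: l(2) sum_basis[OF l(1)])
    qed
    then have basis: "(\<Sum>s\<in>S. w s *\<^sub>R (\<Sum>b\<in>?B. a s b *\<^sub>R I b)) = 0" for w
      by simp
    \<comment> \<open>It suffices to check the basis constraints, since every constraint vector is a
      combination of them on the branches.\<close>
    have "(\<Sum>b\<in>?B. w b *\<^sub>R I b) = 0" if w: "w \<in> ?W" for w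
    proof -
      have "(\<Sum>b\<in>?B. w b *\<^sub>R I b) = (\<Sum>b\<in>?B. (\<Sum>s\<in>S. w s * a s b) *\<^sub>R I b)"
        using expand[OF w] by (intro sum.cong refl) auto
      also have "\<dots> = (\<Sum>s\<in>S. w s *\<^sub>R (\<Sum>b\<in>?B. a s b *\<^sub>R I b))"
        unfolding scaleR_sum_left scaleR_sum_right by (subst sum.swap) simp
      finally show ?thesis using basis by simp
    qed
    then have "current_laws C I"
      by (simp add: current_laws_iff)
    moreover have "I b \<in> L2T T" for b
      using x by (auto simp: I_def split: branch.splits
        intro!: zero_in_L2T uminus_in_L2T sum_in_L2T scaleR_in_L2T)
    ultimately show ?thesis
      using IT by blast
  qed

  have voltage_extension: "\<exists>V. voltage_laws C V \<and> (\<forall>b. V b \<in> L2T T) \<and> (\<forall>k<N. V (Terminals k) = x k)"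
    if x: "\<And>k. k < N \<Longrightarrow> x k \<in> L2T T"
      and rel: "\<And>k. k \<in> {..<N} - F \<Longrightarrow> x k = (\<Sum>l\<in>F. h k l *\<^sub>R x l)" for x
  proof -
    \<comment> \<open>The basis vectors of \<open>F\<close> vanish on internal branches, so they
      extend to voltages; \<open>x l\<close> serves as the weight of the vector of
      \<open>l\<close>.\<close>
    have "a (Terminals l) \<in> ?W" if "l \<in> F" for l
      using that aW by (auto simp: F_def)
    moreover have "a (Terminals l) b = 0" if "l \<in> F" "b \<in> ?B - range Terminals" for l b
      using that SP by (intro aQ) (auto simp: Q_def)
    ultimately obtain c where c: "voltage_laws C (\<lambda>b. \<Sum>l\<in>F. c l b *\<^sub>R x l)"
      and cT: "\<And>l k. l \<in> F \<Longrightarrow> Terminals k \<in> ?B \<Longrightarrow> c l (Terminals k) = a (Terminals l) (Terminals k)"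
      using voltages_of_current_constraints[of F "\<lambda>l. a (Terminals l)" C x] by blast
    have "(\<Sum>l\<in>F. c l (Terminals k) *\<^sub>R x l) = x k" if k: "k < N" for k
    proof -
      have "(\<Sum>l\<in>F. c l (Terminals k) *\<^sub>R x l) = (\<Sum>l\<in>F. h k l *\<^sub>R x l)"
        by (intro sum.cong refl) (simp add: cT TB k h_def)
      also have "\<dots> = x k"
      proof (cases "k \<in> F")
        case True
        then have "(\<Sum>l\<in>F. h k l *\<^sub>R x l) = (\<Sum>l\<in>F. if l = k then x l else 0)"
          by (intro sum.cong refl) (auto simp: h_delta)
        with True finF show ?thesis by simp
      next
        case False
        with k show ?thesis using rel[of k] by simp
      qed
      finally show ?thesis .
    qed
    moreover have "(\<Sum>l\<in>F. c l b *\<^sub>R x l) \<in> L2T T" for b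
      using x Fsub by (intro sum_in_L2T scaleR_in_L2T) auto
    ultimately show ?thesis
      using c by (intro exI[of _ "\<lambda>b. \<Sum>l\<in>F. c l b *\<^sub>R x l"]) auto
  qed

  have beh: "(\<iota>, \<nu>) \<in> behavior T C \<longleftrightarrow> \<iota> \<in> L2T_vec T N \<and> \<nu> \<in> L2T_vec T N \<and>
      (\<forall>j<length (elements C).
        (\<iota> $ (num_ports C + j), \<nu> $ (num_ports C + j)) \<in> impedance (elements C ! j)) \<and>
      (\<forall>k\<in>{..<N} - F. \<nu> $ k = (\<Sum>l\<in>F. h k l *\<^sub>R \<nu> $ l)) \<and>
      (\<forall>l\<in>F. \<iota> $ l = - (\<Sum>k\<in>{..<N} - F. h k l *\<^sub>R \<iota> $ k))" (is "_ \<longleftrightarrow> ?R") for \<iota> \<nu>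
  proof
    assume "(\<iota>, \<nu>) \<in> behavior T C"
    then obtain I V where L: "\<forall>b\<in>?B. I b \<in> L2T T \<and> V b \<in> L2T T"
      and laws: "current_laws C I" "voltage_laws C V"
      and el: "\<forall>j<length (elements C).
        (I (Terminals (num_ports C + j)), V (Terminals (num_ports C + j))) \<in> impedance (elements C ! j)"
      and \<iota>: "\<iota> = Matrix.vec N (\<lambda>k. I (Terminals k))" and \<nu>: "\<nu> = Matrix.vec N (\<lambda>k. V (Terminals k))"
      unfolding behavior_def box_laws_iff N by auto
    have \<iota>k: "\<iota> $ k = I (Terminals k)" and \<nu>k: "\<nu> $ k = V (Terminals k)" if "k < N" for k
      using that by (auto simp: \<iota> \<nu>)
    have "\<nu> $ k = (\<Sum>l\<in>F. h k l *\<^sub>R \<nu> $ l)" if "k < N" for k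
      using voltage_relation[OF laws(2) that] Fsub that
      by (auto simp: \<nu>k subset_eq intro!: sum.cong)
    moreover have "\<iota> $ l = - (\<Sum>k\<in>{..<N} - F. h k l *\<^sub>R \<iota> $ k)" if "l \<in> F" for l
      using current_relation[OF laws(1) that] Fsub that
      by (auto simp: \<iota>k subset_eq intro!: sum.cong)
    moreover have "\<iota> \<in> L2T_vec T N" "\<nu> \<in> L2T_vec T N"
      using L TB unfolding L2T_vec_def \<iota> \<nu> by simp_all
    moreover have "(\<iota> $ (num_ports C + j), \<nu> $ (num_ports C + j)) \<in> impedance (elements C ! j)"
      if "j < length (elements C)" for j
    proof -
      have "num_ports C + j < N"
        using that by (simp add: N num_pairs_def)
      with el that show ?thesis
        unfolding \<iota>k[OF \<open>num_ports C + j < N\<close>] \<nu>k[OF \<open>num_ports C + j < N\<close>] by blast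
    qed
    ultimately show ?R
      by blast
  next
    assume R: ?R
    then have dims: "\<iota> \<in> carrier_vec N" "\<nu> \<in> carrier_vec N"
      by (auto simp: L2T_vec_def)
    obtain I where I: "current_laws C I" "\<forall>b. I b \<in> L2T T" "\<forall>k<N. I (Terminals k) = \<iota> $ k"
      using current_extension[of "\<lambda>k. \<iota> $ k"] R by (auto simp: L2T_vec_def)
    obtain V where V: "voltage_laws C V" "\<forall>b. V b \<in> L2T T" "\<forall>k<N. V (Terminals k) = \<nu> $ k"
      using voltage_extension[of "\<lambda>k. \<nu> $ k"] R by (auto simp: L2T_vec_def)
    have "(I (Terminals (num_ports C + j)), V (Terminals (num_ports C + j))) \<in> impedance (elements C ! j)"
      if "j < length (elements C)" for j
      using R that I(3) V(3) by (simp add: N num_pairs_def)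
    moreover have "\<iota> = Matrix.vec N (\<lambda>k. I (Terminals k))" "\<nu> = Matrix.vec N (\<lambda>k. V (Terminals k))"
      using dims I(3) V(3) by auto
    ultimately show "(\<iota>, \<nu>) \<in> behavior T C"
      using I(1,2) V(1,2) unfolding behavior_def box_laws_iff N by blast
  qed
  have "behavior T C = {(\<iota>, \<nu>). \<iota> \<in> L2T_vec T N \<and> \<nu> \<in> L2T_vec T N \<and>
      (\<forall>j<length (elements C).
        (\<iota> $ (num_ports C + j), \<nu> $ (num_ports C + j)) \<in> impedance (elements C ! j)) \<and>
      (\<forall>k\<in>{..<N} - F. \<nu> $ k = (\<Sum>l\<in>F. h k l *\<^sub>R \<nu> $ l)) \<and>
      (\<forall>l\<in>F. \<iota> $ l = - (\<Sum>k\<in>{..<N} - F. h k l *\<^sub>R \<iota> $ k))}"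
    unfolding set_eq_iff split_paired_All mem_Collect_eq case_prod_conv beh by blast
  with Fsub show ?thesis
    by (rule that)
qed

section \<open>The circuit equations\<close>

lemma monotone_operator_concatenation:
  assumes "\<And>A. A \<in> set As \<Longrightarrow> monotone_operator (L2T T) inner A"
  shows "monotone_operator (L2T_vec T (length As)) inner_vec (concatenation As)"
proof -
  have A: "monotone_operator (L2T T) inner (As ! j)" if "j < length As" for j
    using assms that by simp
  have "concatenation As \<subseteq> L2T_vec T (length As) \<times> L2T_vec T (length As)"
    using A by (fastforce simp: concatenation_def L2T_vec_def monotone_operator_def)
  moreover have "0 \<le> inner_vec (x1 - x2) (y1 - y2)"
    if "(x1, y1) \<in> concatenation As" "(x2, y2) \<in> concatenation As" for x1 y1 x2 y2
    unfolding inner_vec_def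
  proof (rule sum_nonneg)
    fix j assume "j \<in> {..<dim_vec (y1 - y2)}"
    then have j: "j < length As"
      using that by (auto simp: concatenation_def)
    then have "(x1 $ j, y1 $ j) \<in> As ! j" "(x2 $ j, y2 $ j) \<in> As ! j"
      using that by (auto simp: concatenation_def)
    then have "0 \<le> inner (x1 $ j - x2 $ j) (y1 $ j - y2 $ j)"
      using A[OF j] unfolding monotone_operator_def by blast
    then show "0 \<le> inner ((x1 - x2) $ j) ((y1 - y2) $ j)"
      using that j by (auto simp: concatenation_def)
  qed
  ultimately show ?thesis
    unfolding monotone_operator_def by blast
qed

lemma monotone_operator_converse:
  "monotone_operator H inner A \<Longrightarrow> monotone_operator H inner (A\<inverse>)"
  by (fastforce simp: monotone_operator_def inner_commute)

lemma monotone_impedance: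
  "monotone_operator H inner (operator_of e) \<Longrightarrow> monotone_operator H inner (impedance e)"
  by (cases e) (auto intro: monotone_operator_converse)

lemma monotone_admittance:
  "monotone_operator H inner (operator_of e) \<Longrightarrow> monotone_operator H inner (admittance e)"
  by (cases e) (auto intro: monotone_operator_converse)

lemma admittance_iff: "(v, i) \<in> admittance e \<longleftrightarrow> (i, v) \<in> impedance e"
  by (cases e) auto

text \<open>Rows of the matrix equations, in a form that can be compared with the relations given by
  \<open>h\<close>.\<close>

lemma circuit_equations_iff:
  fixes M B\<^sub>R B\<^sub>G D :: "real mat"
  assumes M: "M \<in> carrier_mat q p" and BR: "B\<^sub>R \<in> carrier_mat p m" and BG: "B\<^sub>G \<in> carrier_mat q m"
    and D: "D \<in> carrier_mat m m"
    and i: "i \<in> carrier_vec p" and r: "r \<in> carrier_vec p" and v: "v \<in> carrier_vec q"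
    and g: "g \<in> carrier_vec q" and u: "u \<in> carrier_vec m" and y: "y \<in> carrier_vec m"
  shows "0\<^sub>v (p + q) = (r @\<^sub>v g)
      + tensor_Id (four_block_mat (0\<^sub>m p p) (transpose_mat M) (- M) (0\<^sub>m q q)) (i @\<^sub>v v)
      - tensor_Id (B\<^sub>R @\<^sub>r B\<^sub>G) u \<longleftrightarrow>
    (\<forall>e<p. r $ e + (\<Sum>f<q. M $$ (f, e) *\<^sub>R v $ f) = (\<Sum>k<m. B\<^sub>R $$ (e, k) *\<^sub>R u $ k)) \<and>
    (\<forall>f<q. g $ f - (\<Sum>e<p. M $$ (f, e) *\<^sub>R i $ e) = (\<Sum>k<m. B\<^sub>G $$ (f, k) *\<^sub>R u $ k))"
    (is ?circuit)
  and "y = - tensor_Id (transpose_mat (B\<^sub>R @\<^sub>r B\<^sub>G)) (i @\<^sub>v v) + tensor_Id D u \<longleftrightarrow>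
    (\<forall>k<m. y $ k = - ((\<Sum>e<p. B\<^sub>R $$ (e, k) *\<^sub>R i $ e) + (\<Sum>f<q. B\<^sub>G $$ (f, k) *\<^sub>R v $ f))
      + (\<Sum>l<m. D $$ (k, l) *\<^sub>R u $ l))" (is ?response)
proof -
  have dims: "dim_row (B\<^sub>R @\<^sub>r B\<^sub>G) = p + q" "dim_col (B\<^sub>R @\<^sub>r B\<^sub>G) = m"
    using BR BG by (auto simp: append_rows_def)
  have B1: "(B\<^sub>R @\<^sub>r B\<^sub>G) $$ (e, k) = B\<^sub>R $$ (e, k)" if "e < p" "k < m" for e k
    using that BR BG by (auto simp: append_rows_def)
  have B2: "(B\<^sub>R @\<^sub>r B\<^sub>G) $$ (p + f, k) = B\<^sub>G $$ (f, k)" if "f < q" "k < m" for f k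
    using that BR BG by (auto simp: append_rows_def)
  have Bu: "tensor_Id (B\<^sub>R @\<^sub>r B\<^sub>G) u $ j = (\<Sum>k<m. (B\<^sub>R @\<^sub>r B\<^sub>G) $$ (j, k) *\<^sub>R u $ k)" if "j < p + q" for j
    using that by (simp add: tensor_Id_def dims)
  note J = tensor_Id_skew_block[OF M i v]
  show ?circuit
    unfolding vec_eq_iff using r g i v
    by (simp add: J all_less_add_iff Bu B1 B2 dims eq_commute[of 0] del: index_mat_four_block)
  have "tensor_Id (transpose_mat (B\<^sub>R @\<^sub>r B\<^sub>G)) (i @\<^sub>v v) $ k =
      (\<Sum>e<p. B\<^sub>R $$ (e, k) *\<^sub>R i $ e) + (\<Sum>f<q. B\<^sub>G $$ (f, k) *\<^sub>R v $ f)" if "k < m" for k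
    using that i v by (simp add: tensor_Id_def dims sum_lessThan_add B1 B2)
  then show ?response
    unfolding vec_eq_iff using D y by (simp add: dims) (simp add: tensor_Id_def)
qed

text \<open>Terminal pairs below \<open>m\<close> are driving points and \<open>m + e\<close>
  carries element \<open>e\<close>; the list \<open>xs\<close> renumbers the elements in
  \<open>A\<close> as components of a vector.\<close>

lemma sum_filter_upt:
  fixes g :: "nat \<Rightarrow> 'a::comm_monoid_add"
  assumes A: "A \<subseteq> {..<m + n}" and xs: "xs = filter (\<lambda>e. m + e \<in> A) [0..<n]"
  shows "sum g A = (\<Sum>k<m. if k \<in> A then g k else 0) + (\<Sum>j<length xs. g (m + xs ! j))"
proof -
  have "sum g A = (\<Sum>k<m + n. if k \<in> A then g k else 0)"
    using A by (simp add: sum.If_cases Int_absorb1)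
  also have "\<dots> = (\<Sum>k<m. if k \<in> A then g k else 0) + (\<Sum>e<n. if m + e \<in> A then g (m + e) else 0)"
    by (rule sum_lessThan_add)
  also have "(\<Sum>e<n. if m + e \<in> A then g (m + e) else 0) = (\<Sum>e\<in>set xs. g (m + e))"
    by (subst sum.inter_filter[symmetric]) (auto simp: xs intro!: sum.cong)
  also have "\<dots> = (\<Sum>j<length xs. g (m + xs ! j))"
    using sum.reindex_bij_betw[OF bij_betw_nth[of xs "{..<length xs}" "set xs"], of "\<lambda>e. g (m + e)"]
    by (simp add: xs)
  finally show ?thesis .
qed

lemma ball_filter_upt:
  assumes A: "A \<subseteq> {..<m + n}" and xs: "xs = filter (\<lambda>e. m + e \<in> A) [0..<n]"
  shows "(\<forall>k\<in>A. P k) \<longleftrightarrow> (\<forall>k<m. k \<in> A \<longrightarrow> P k) \<and> (\<forall>j<length xs. P (m + xs ! j))"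
proof -
  have "(\<forall>k\<in>A. P k) \<longleftrightarrow> (\<forall>k<m + n. k \<in> A \<longrightarrow> P k)"
    using A by auto
  also have "\<dots> \<longleftrightarrow> (\<forall>k<m. k \<in> A \<longrightarrow> P k) \<and> (\<forall>e\<in>set xs. P (m + e))"
    unfolding all_less_add_iff by (auto simp: xs)
  finally show ?thesis
    by (simp add: all_set_conv_all_nth)
qed

theorem theorem1:
  fixes T :: real and m n :: nat and C :: "'v circuit"
  assumes "T > 0" and "monotone_circuit T m n C"
  shows "\<exists>S es fs p q M B\<^sub>R B\<^sub>G D R G.
    S \<subseteq> {..<m} \<and>
    length es = p \<and> length fs = q \<and> p + q = n \<and>
    distinct (es @ fs) \<and> set (es @ fs) = {..<n} \<and>
    M \<in> carrier_mat q p \<and> B\<^sub>R \<in> carrier_mat p m \<and> B\<^sub>G \<in> carrier_mat q m \<and> D \<in> carrier_mat m m \<and>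
    monotone_operator (L2T_vec T p) inner_vec R \<and>
    R = concatenation (map (\<lambda>e. impedance (elements C ! e)) es) \<and>
    monotone_operator (L2T_vec T q) inner_vec G \<and>
    G = concatenation (map (\<lambda>e. admittance (elements C ! e)) fs) \<and>
    behavior T C =
      {(\<iota>, \<nu>). \<iota> \<in> L2T_vec T (m + n) \<and> \<nu> \<in> L2T_vec T (m + n) \<and>
        (let u = excitation m S \<iota> \<nu>; y = response m S \<iota> \<nu>;
             i = element_part m es \<iota>; v = element_part m fs \<nu>;
             r = element_part m es \<nu>; g = element_part m fs \<iota> in
           (i, r) \<in> R \<and> (v, g) \<in> G \<and>
           0\<^sub>v n = (r @\<^sub>v g)
             + tensor_Id (four_block_mat (0\<^sub>m p p) (transpose_mat M) (- M) (0\<^sub>m q q)) (i @\<^sub>v v)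
             - tensor_Id (B\<^sub>R @\<^sub>r B\<^sub>G) u \<and>
           y = - tensor_Id (transpose_mat (B\<^sub>R @\<^sub>r B\<^sub>G)) (i @\<^sub>v v) + tensor_Id D u)}"
proof -
  have ports: "num_ports C = m" and els: "length (elements C) = n"
    and mono: "\<And>e. e < n \<Longrightarrow> monotone_operator (L2T T) inner (operator_of (elements C ! e))"
    using assms(2) by (auto simp: monotone_circuit_def maximal_monotone_operator_def)
  have N: "m + n = num_pairs C"
    by (simp add: num_pairs_def ports els)
  obtain F h where F: "F \<subseteq> {..<m + n}"
    and beh: "behavior T C = {(\<iota>, \<nu>). \<iota> \<in> L2T_vec T (m + n) \<and> \<nu> \<in> L2T_vec T (m + n) \<and>
      (\<forall>j<length (elements C).
        (\<iota> $ (num_ports C + j), \<nu> $ (num_ports C + j)) \<in> impedance (elements C ! j)) \<and>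
      (\<forall>k\<in>{..<m + n} - F. \<nu> $ k = (\<Sum>l\<in>F. h k l *\<^sub>R \<nu> $ l)) \<and>
      (\<forall>l\<in>F. \<iota> $ l = - (\<Sum>k\<in>{..<m + n} - F. h k l *\<^sub>R \<iota> $ k))}"
    using behavior_coordinates[OF N, of T] by blast
  let ?E = "{..<m + n} - F"
  \<comment> \<open>Independent variables are the voltages in \<open>F\<close> and the currents
    outside \<open>F\<close>; hence driving points outside \<open>F\<close> are excited by a
    current.\<close>
  define S where "S = {..<m} - F"
  define es fs where "es = filter (\<lambda>e. m + e \<in> ?E) [0..<n]" and "fs = filter (\<lambda>e. m + e \<in> F) [0..<n]"
  define p q where "p = length es" and "q = length fs"
  \<comment> \<open>The blocks are read off from \<open>h\<close>. An entry of
    \<open>B\<^sub>R\<close> or \<open>B\<^sub>G\<close> is zero when the excitation is of the wrong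
    kind: a voltage depends only on the voltages in \<open>F\<close>, a current in \<open>F\<close>
    only on the currents outside \<open>F\<close>.\<close>
  define M where "M = Matrix.mat q p (\<lambda>(f, e). - h (m + es ! e) (m + fs ! f))"
  define B\<^sub>R where "B\<^sub>R = Matrix.mat p m (\<lambda>(e, k). if k \<in> F then h (m + es ! e) k else 0)"
  define B\<^sub>G where "B\<^sub>G = Matrix.mat q m (\<lambda>(f, k). if k \<in> F then 0 else - h k (m + fs ! f))"
  \<comment> \<open>The part of the skew symmetric system between driving points.\<close>
  define D where "D = Matrix.mat m m (\<lambda>(k, l).
    if k \<in> F then if l \<in> F then 0 else - h l k else if l \<in> F then h k l else 0)"
  define R where "R = concatenation (map (\<lambda>e. impedance (elements C ! e)) es)"
  define G where "G = concatenation (map (\<lambda>e. admittance (elements C ! e)) fs)"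
  have carriers: "M \<in> carrier_mat q p" "B\<^sub>R \<in> carrier_mat p m" "B\<^sub>G \<in> carrier_mat q m" "D \<in> carrier_mat m m"
    by (auto simp: M_def B\<^sub>R_def B\<^sub>G_def D_def)
  have part: "distinct (es @ fs)" "set (es @ fs) = {..<n}"
    by (auto simp: es_def fs_def)
  have pq: "p + q = n"
    using distinct_card[OF part(1)] unfolding part(2) by (simp add: p_def q_def)
  have lt: "e \<in> set es \<Longrightarrow> e < n" "e \<in> set fs \<Longrightarrow> e < n" for e
    by (auto simp: es_def fs_def)
  have monoR: "monotone_operator (L2T_vec T p) inner_vec R"
    using monotone_operator_concatenation[of "map (\<lambda>e. impedance (elements C ! e)) es" T]
      monotone_impedance[OF mono[OF lt(1)]] by (auto simp: R_def p_def)
  have monoG: "monotone_operator (L2T_vec T q) inner_vec G"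
    using monotone_operator_concatenation[of "map (\<lambda>e. admittance (elements C ! e)) fs" T]
      monotone_admittance[OF mono[OF lt(2)]] by (auto simp: G_def q_def)
  have mem: "(\<iota>, \<nu>) \<in> behavior T C \<longleftrightarrow> \<iota> \<in> L2T_vec T (m + n) \<and> \<nu> \<in> L2T_vec T (m + n) \<and>
        (let u = excitation m S \<iota> \<nu>; y = response m S \<iota> \<nu>;
             i = element_part m es \<iota>; v = element_part m fs \<nu>;
             r = element_part m es \<nu>; g = element_part m fs \<iota> in
           (i, r) \<in> R \<and> (v, g) \<in> G \<and>
           0\<^sub>v n = (r @\<^sub>v g)
             + tensor_Id (four_block_mat (0\<^sub>m p p) (transpose_mat M) (- M) (0\<^sub>m q q)) (i @\<^sub>v v)
             - tensor_Id (B\<^sub>R @\<^sub>r B\<^sub>G) u \<and>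
           y = - tensor_Id (transpose_mat (B\<^sub>R @\<^sub>r B\<^sub>G)) (i @\<^sub>v v) + tensor_Id D u)" for \<iota> \<nu>
  proof -
    define u y where "u = excitation m S \<iota> \<nu>" and "y = response m S \<iota> \<nu>"
    \<comment> \<open>\<open>i\<close> and \<open>v\<close> are the independent element variables;
      \<open>r\<close> and \<open>g\<close> are the values selected from \<open>R\<close> and
      \<open>G\<close>.\<close>
    define i v r g where "i = element_part m es \<iota>" and "v = element_part m fs \<nu>"
      and "r = element_part m es \<nu>" and "g = element_part m fs \<iota>"
    have vecs: "i \<in> carrier_vec p" "r \<in> carrier_vec p" "v \<in> carrier_vec q" "g \<in> carrier_vec q"
      "u \<in> carrier_vec m" "y \<in> carrier_vec m"
      by (auto simp: i_def r_def v_def g_def u_def y_def element_part_def p_def q_def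
          excitation_def response_def)
    have u: "u $ k = (if k \<in> F then \<nu> $ k else \<iota> $ k)"
      and y: "y $ k = (if k \<in> F then \<iota> $ k else \<nu> $ k)" if "k < m" for k
      using that by (auto simp: u_def y_def S_def excitation_def response_def)
    have i: "i $ e = \<iota> $ (m + es ! e)" and r: "r $ e = \<nu> $ (m + es ! e)" if "e < p" for e
      using that by (auto simp: i_def r_def element_part_def p_def)
    have v: "v $ f = \<nu> $ (m + fs ! f)" and g: "g $ f = \<iota> $ (m + fs ! f)" if "f < q" for f
      using that by (auto simp: v_def g_def element_part_def q_def)
    note ball_E = ball_filter_upt[of ?E m n es, OF _ es_def, folded p_def]
    note ball_F = ball_filter_upt[OF F fs_def, folded q_def]

    \<comment> \<open>An admittance is the inverse of the impedance, so each membership states the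
      impedance law of one element, and \<open>es\<close> and \<open>fs\<close> together list every
      element once.\<close>
    have elements: "(\<forall>j<length (elements C).
        (\<iota> $ (num_ports C + j), \<nu> $ (num_ports C + j)) \<in> impedance (elements C ! j)) \<longleftrightarrow>
        (i, r) \<in> R \<and> (v, g) \<in> G"
    proof -
      have "(i, r) \<in> R \<longleftrightarrow> (\<forall>e\<in>set es. (\<iota> $ (m + e), \<nu> $ (m + e)) \<in> impedance (elements C ! e))"
        using vecs by (auto simp: R_def concatenation_def all_set_conv_all_nth i r p_def)
      moreover have "(v, g) \<in> G \<longleftrightarrow> (\<forall>e\<in>set fs. (\<iota> $ (m + e), \<nu> $ (m + e)) \<in> impedance (elements C ! e))"
        using vecs by (auto simp: G_def concatenation_def all_set_conv_all_nth v g q_def admittance_iff)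
      moreover have "(\<forall>j<n. P j) \<longleftrightarrow> (\<forall>e\<in>set es. P e) \<and> (\<forall>e\<in>set fs. P e)" for P
      proof -
        have "(\<forall>j<n. P j) \<longleftrightarrow> (\<forall>j\<in>set (es @ fs). P j)"
          unfolding part(2) by auto
        then show ?thesis by auto
      qed
      ultimately show ?thesis
        by (simp add: ports els)
    qed

    have sum_F: "(\<Sum>l\<in>F. h k l *\<^sub>R \<nu> $ l) =
        (\<Sum>l<m. if l \<in> F then h k l *\<^sub>R \<nu> $ l else 0) + (\<Sum>f<q. h k (m + fs ! f) *\<^sub>R v $ f)" for k
      using sum_filter_upt[OF F fs_def, of "\<lambda>l. h k l *\<^sub>R \<nu> $ l"] by (simp add: v q_def)
    have sum_E: "(\<Sum>k\<in>?E. h k l *\<^sub>R \<iota> $ k) =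
        (\<Sum>k<m. if k \<in> F then 0 else h k l *\<^sub>R \<iota> $ k) + (\<Sum>e<p. h (m + es ! e) l *\<^sub>R i $ e)" for l
    proof -
      have "(\<Sum>k<m. if k \<in> ?E then h k l *\<^sub>R \<iota> $ k else 0) = (\<Sum>k<m. if k \<in> F then 0 else h k l *\<^sub>R \<iota> $ k)"
        by (intro sum.cong refl) auto
      then show ?thesis
        using sum_filter_upt[of ?E m n es "\<lambda>k. h k l *\<^sub>R \<iota> $ k", OF _ es_def] by (simp add: i p_def)
    qed

    have BRu: "(\<Sum>k<m. B\<^sub>R $$ (e, k) *\<^sub>R u $ k) =
        (\<Sum>l<m. if l \<in> F then h (m + es ! e) l *\<^sub>R \<nu> $ l else 0)" if "e < p" for e
      using that by (intro sum.cong refl) (simp add: B\<^sub>R_def u)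
    have BGu: "(\<Sum>k<m. B\<^sub>G $$ (f, k) *\<^sub>R u $ k) =
        - (\<Sum>k<m. if k \<in> F then 0 else h k (m + fs ! f) *\<^sub>R \<iota> $ k)" if "f < q" for f
      unfolding sum_negf[symmetric] using that by (intro sum.cong refl) (simp add: B\<^sub>G_def u)
    have Mv: "(\<Sum>f<q. M $$ (f, e) *\<^sub>R v $ f) = - (\<Sum>f<q. h (m + es ! e) (m + fs ! f) *\<^sub>R v $ f)"
      if "e < p" for e
      unfolding sum_negf[symmetric] using that by (intro sum.cong refl) (simp add: M_def)
    have Mi: "(\<Sum>e<p. M $$ (f, e) *\<^sub>R i $ e) = - (\<Sum>e<p. h (m + es ! e) (m + fs ! f) *\<^sub>R i $ e)"
      if "f < q" for f
      unfolding sum_negf[symmetric] using that by (intro sum.cong refl) (simp add: M_def)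
    have BRi: "(\<Sum>e<p. B\<^sub>R $$ (e, k) *\<^sub>R i $ e) =
        (if k \<in> F then \<Sum>e<p. h (m + es ! e) k *\<^sub>R i $ e else 0)" if "k < m" for k
      using that by (simp add: B\<^sub>R_def)
    have BGv: "(\<Sum>f<q. B\<^sub>G $$ (f, k) *\<^sub>R v $ f) =
        (if k \<in> F then 0 else - (\<Sum>f<q. h k (m + fs ! f) *\<^sub>R v $ f))" if "k < m" for k
      using that by (simp add: B\<^sub>G_def sum_negf)
    have Du: "(\<Sum>l<m. D $$ (k, l) *\<^sub>R u $ l) =
        (if k \<in> F then - (\<Sum>l<m. if l \<in> F then 0 else h l k *\<^sub>R \<iota> $ l)
         else \<Sum>l<m. if l \<in> F then h k l *\<^sub>R \<nu> $ l else 0)" if "k < m" for k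
      using that by (auto simp: D_def u sum_negf[symmetric] intro!: sum.cong)

    \<comment> \<open>The voltage relations split into driving points and \<open>es\<close>, the
      current relations into driving points and \<open>fs\<close>. The element parts are the two
      block rows of the inclusion; the driving point parts together form the response
      equation.\<close>
    have interconnection: "(\<forall>k\<in>?E. \<nu> $ k = (\<Sum>l\<in>F. h k l *\<^sub>R \<nu> $ l)) \<and>
        (\<forall>l\<in>F. \<iota> $ l = - (\<Sum>k\<in>?E. h k l *\<^sub>R \<iota> $ k)) \<longleftrightarrow>
        (\<forall>e<p. r $ e + (\<Sum>f<q. M $$ (f, e) *\<^sub>R v $ f) = (\<Sum>k<m. B\<^sub>R $$ (e, k) *\<^sub>R u $ k)) \<and>
        (\<forall>f<q. g $ f - (\<Sum>e<p. M $$ (f, e) *\<^sub>R i $ e) = (\<Sum>k<m. B\<^sub>G $$ (f, k) *\<^sub>R u $ k)) \<and>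
        (\<forall>k<m. y $ k = - ((\<Sum>e<p. B\<^sub>R $$ (e, k) *\<^sub>R i $ e) + (\<Sum>f<q. B\<^sub>G $$ (f, k) *\<^sub>R v $ f))
          + (\<Sum>l<m. D $$ (k, l) *\<^sub>R u $ l))"
      (is "?V \<and> ?I \<longleftrightarrow> ?r \<and> ?g \<and> ?y")
    proof -
      have "?V \<longleftrightarrow> (\<forall>k<m. k \<notin> F \<longrightarrow> \<nu> $ k = (\<Sum>l\<in>F. h k l *\<^sub>R \<nu> $ l)) \<and>
          (\<forall>e<p. \<nu> $ (m + es ! e) = (\<Sum>l\<in>F. h (m + es ! e) l *\<^sub>R \<nu> $ l))"
        by (subst ball_E) auto
      moreover have "?I \<longleftrightarrow> (\<forall>k<m. k \<in> F \<longrightarrow> \<iota> $ k = - (\<Sum>l\<in>?E. h l k *\<^sub>R \<iota> $ l)) \<and>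
          (\<forall>f<q. \<iota> $ (m + fs ! f) = - (\<Sum>l\<in>?E. h l (m + fs ! f) *\<^sub>R \<iota> $ l))"
        by (rule ball_F)
      moreover have "?r \<longleftrightarrow> (\<forall>e<p. \<nu> $ (m + es ! e) = (\<Sum>l\<in>F. h (m + es ! e) l *\<^sub>R \<nu> $ l))"
        by (simp add: r Mv BRu sum_F algebra_simps)
      moreover have "?g \<longleftrightarrow> (\<forall>f<q. \<iota> $ (m + fs ! f) = - (\<Sum>l\<in>?E. h l (m + fs ! f) *\<^sub>R \<iota> $ l))"
        by (simp add: g Mi BGu sum_E algebra_simps eq_neg_iff_add_eq_0)
      moreover have "?y \<longleftrightarrow> (\<forall>k<m. (k \<notin> F \<longrightarrow> \<nu> $ k = (\<Sum>l\<in>F. h k l *\<^sub>R \<nu> $ l)) \<and>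
          (k \<in> F \<longrightarrow> \<iota> $ k = - (\<Sum>l\<in>?E. h l k *\<^sub>R \<iota> $ l)))"
        by (intro all_cong1 imp_cong refl) (simp add: y BRi BGv Du sum_F sum_E add.commute)
      ultimately show ?thesis by blast
    qed
    show ?thesis
      unfolding beh mem_Collect_eq case_prod_conv Let_def u_def[symmetric] y_def[symmetric]
        i_def[symmetric] v_def[symmetric] r_def[symmetric] g_def[symmetric] elements interconnection
        circuit_equations_iff[OF carriers vecs, unfolded pq]
      by blast
  qed
  show ?thesis
    apply (rule exI[of _ S], rule exI[of _ es], rule exI[of _ fs], rule exI[of _ p],
        rule exI[of _ q], rule exI[of _ M], rule exI[of _ B\<^sub>R], rule exI[of _ B\<^sub>G],
        rule exI[of _ D], rule exI[of _ R], rule exI[of _ G])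
    apply (intro conjI pq carriers part monoR monoG p_def[symmetric] q_def[symmetric] R_def G_def)
     apply (simp add: S_def)
    unfolding set_eq_iff split_paired_All mem_Collect_eq case_prod_conv
    by (intro allI mem)
qed

end
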